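(* Let $\mathcal{H},\mathcal{H}_1,\mathcal{H}_2$ be separable infinite-dimensional Hilbert spaces, let $A_1:\mathcal{H}\to\mathcal{H}_1$ and $A_2:\mathcal{H}\to\mathcal{H}_2$ be compact operators of infinite rank, and let $\mathcal{Y}_i=A_i\mathcal{H}$ for $i=1,2$. Suppose that $\mathcal{Y}_1$ majorizes $\mathcal{Y}_2$ (that is, $d(\mathcal{Y}_1)$ majorizes $d(\mathcal{Y}_2)$). Then: (i) If all left shifts of $d(\mathcal{Y}_1)$ majorize $d(\mathcal{Y}_2)$, then $\mathcal{W}\mathcal{R}(\mathcal{Y}_1,\mathcal{Y}_2)=\mathcal{L}(\mathcal{H}_1,\mathcal{H}_2)$. (ii) Let $k$ be a non-negative integer. If the $k$-th left shift of $d(\mathcal{Y}_1)$ majorizes $d(\mathcal{Y}_2)$, but the $(k+1)$-th left shift does not, then $\mathcal{W}\mathcal{R}(\mathcal{Y}_1,\mathcal{Y}_2)$ is the set of those operators $T\in\mathcal{L}(\mathcal{H}_1,\mathcal{H}_2)$ for which the image of $T\mathcal{Y}_1$ in the quotient space $\mathcal{H}_2/\overline{\mathcal{Y}_2}$ has dimension $\le k$. In particular ($k=0$), if the first left shift of $d(\mathcal{Y}_1)$ does not majorize $d(\mathcal{Y}_2)$, then $T\overline{\mathcal{Y}_1}\subset\overline{\mathcal{Y}_2}$ for every $T\in\mathcal{W}\mathcal{R}(\mathcal{Y}_1,\mathcal{Y}_2)$. (iii) If $\mathcal{Y}_1$ is non-lacunary, then $\mathcal{W}\mathcal{R}(\mathcal{Y}_1,\mathcal{Y}_2)=\mathcal{L}(\mathcal{H}_1,\mathcal{H}_2)$.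 (iv) If $\mathcal{Y}_1$ and $\mathcal{Y}_2$ are dense (in $\mathcal{H}_1$ and $\mathcal{H}_2$ respectively), then $\mathcal{W}\mathcal{R}(\mathcal{Y}_1,\mathcal{Y}_2)=\mathcal{L}(\mathcal{H}_1,\mathcal{H}_2)$.
   Context: $\mathcal{R}(\mathcal{Y}_1,\mathcal{Y}_2)=\{T\in\mathcal{L}(\mathcal{H}_1,\mathcal{H}_2): T\mathcal{Y}_1\supset\mathcal{Y}_2\}$, and $\mathcal{W}\mathcal{R}(\mathcal{Y}_1,\mathcal{Y}_2)$ is its closure in the weak operator topology. If $\mathcal{Y}=A\mathcal{H}$ is the range of a compact operator $A$ of infinite rank between Hilbert spaces, the set $K=A(B_{\mathcal{H}})$ ($B_{\mathcal{H}}$ the closed unit ball) is called a generating ellipsoid of $\mathcal{Y}$. The Kolmogorov $n$-width ($n\ge0$) of a subset $K$ of a Hilbert space is $d_n(K)=\inf_{\mathcal{X}_n}\sup_{x\in K}\inf_{z\in \mathcal{X}_n}\|x-z\|$, the outer infimum being over all $n$-dimensional linear subspaces. A sequence $\{a_n\}_{n=0}^\infty$ of non-negative numbers majorizes $\{b_n\}_{n=0}^\infty$ if there is $0<C<\infty$ with $b_n\le Ca_n$ for all $n$; two sequences of positive numbers are equivalent if each majorizes the other. The equivalence class of $\{d_n(K)\}_{n=0}^\infty$ does not depend on the choice of generating ellipsoid $K$ of $\mathcal{Y}$ and is denoted $d(\mathcal{Y})$. The $k$-th left shift of $\{a_n\}_{n=0}^\infty$ is $\{a_{n+k}\}_{n=0}^\infty$.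 Left shifts and majorization are well defined on equivalence classes. A non-increasing sequence of positive numbers $a_n\to0$ is lacunary if $\liminf_{n\to\infty}a_{n+1}/a_n=0$; this depends only on the equivalence class, and $\mathcal{Y}$ is called lacunary if the sequences in $d(\mathcal{Y})$ are lacunary. *)

theory Defs
  imports "HOL-Analysis.Analysis"
begin

(* Scalars, so that real and complex Hilbert spaces are treated at once.  By the Gelfand-Mazur
   theorem every instance is isometrically isomorphic to the reals or the complex numbers, and the
   last axiom forces scnj to be the identity or complex conjugation, respectively. *)
class rc_field = real_normed_field +
  fixes scnj :: "'a \<Rightarrow> 'a"
  assumes scnj_add: "scnj (x + y) = scnj x + scnj y"
    and scnj_mult: "scnj (x * y) = scnj x * scnj y"
    and mult_scnj: "x * scnj x = (norm x)\<^sup>2 *\<^sub>R 1"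

instantiation real :: rc_field
begin
definition scnj_real :: "real \<Rightarrow> real" where "scnj_real x = x"
instance by standard (auto simp: scnj_real_def power2_eq_square)
end

instantiation complex :: rc_field
begin
definition scnj_complex :: "complex \<Rightarrow> complex" where "scnj_complex = cnj"
instance by standard (simp_all add: scnj_complex_def complex_norm_square[symmetric] scaleR_conv_of_real)
end

(* A Hilbert space over 'k.  Norm, metric and completeness come from the type class; the class
   operation inner is, by polarization, the real part of ip and imposes nothing further. *)
locale hilbert_space = vector_space scale
  for scale :: "'k::rc_field \<Rightarrow> 'a::{real_inner, banach} \<Rightarrow> 'a" +
  fixes ip :: "'a \<Rightarrow> 'a \<Rightarrow> 'k"
  assumes scale_of_real: "scale (of_real r) x = r *\<^sub>R x"
    and ip_add_left: "ip (x + y) z = ip x z + ip y z"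
    and ip_scale_left: "ip (scale c x) y = c * ip x y"
    and ip_commute: "ip y x = scnj (ip x y)"
    and ip_self: "ip x x = of_real ((norm x)\<^sup>2)"

lemma hilbert_space_real:
  "hilbert_space (*\<^sub>R) ((\<bullet>) :: 'a::{real_inner, banach} \<Rightarrow> 'a \<Rightarrow> real)"
  by unfold_locales
    (auto simp: algebra_simps inner_commute scnj_real_def power2_norm_eq_inner)

lemma hilbert_space_complex:
  "hilbert_space (*) (\<lambda>x y :: complex. x * cnj y)"
proof unfold_locales
  show "x * cnj x = of_real ((norm x)\<^sup>2)" for x :: complex
    by (simp only: complex_norm_square)
qed (auto simp: algebra_simps scnj_complex_def scaleR_conv_of_real)

definition infinite_dimensional ::
    "('k::field \<Rightarrow> 'a::ab_group_add \<Rightarrow> 'a) \<Rightarrow> 'a set \<Rightarrow> bool" where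
  "infinite_dimensional s V \<longleftrightarrow> \<not> (\<exists>B. finite B \<and> V \<subseteq> module.span s B)"

definition bounded_operators ::
    "('k::field \<Rightarrow> 'a::real_normed_vector \<Rightarrow> 'a) \<Rightarrow>
     ('k \<Rightarrow> 'b::real_normed_vector \<Rightarrow> 'b) \<Rightarrow> ('a \<Rightarrow> 'b) set" where
  "bounded_operators s1 s2 = {T. Vector_Spaces.linear s1 s2 T \<and> bounded_linear T}"

definition compact_operator ::
    "('k::field \<Rightarrow> 'a::real_normed_vector \<Rightarrow> 'a) \<Rightarrow>
     ('k \<Rightarrow> 'b::real_normed_vector \<Rightarrow> 'b) \<Rightarrow> ('a \<Rightarrow> 'b) \<Rightarrow> bool" where
  "compact_operator s1 s2 A \<longleftrightarrow>
     A \<in> bounded_operators s1 s2 \<and> compact (closure (A ` cball 0 1))"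

definition weak_operator_topology ::
    "('k::real_normed_field \<Rightarrow> 'a::real_normed_vector \<Rightarrow> 'a) \<Rightarrow>
     ('k \<Rightarrow> 'b::real_normed_vector \<Rightarrow> 'b) \<Rightarrow> ('b \<Rightarrow> 'b \<Rightarrow> 'k) \<Rightarrow>
     ('a \<Rightarrow> 'b) topology" where
  "weak_operator_topology s1 s2 ip2 =
     pullback_topology (bounded_operators s1 s2) (\<lambda>T (x, y). ip2 (T x) y) euclidean"

definition range_covering ::
    "('k::field \<Rightarrow> 'a::real_normed_vector \<Rightarrow> 'a) \<Rightarrow>
     ('k \<Rightarrow> 'b::real_normed_vector \<Rightarrow> 'b) \<Rightarrow> 'a set \<Rightarrow> 'b set \<Rightarrow> ('a \<Rightarrow> 'b) set" where
  "range_covering s1 s2 Y1 Y2 = {T \<in> bounded_operators s1 s2. Y2 \<subseteq> T ` Y1}"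

definition weak_range_covering ::
    "('k::real_normed_field \<Rightarrow> 'a::real_normed_vector \<Rightarrow> 'a) \<Rightarrow>
     ('k \<Rightarrow> 'b::real_normed_vector \<Rightarrow> 'b) \<Rightarrow> ('b \<Rightarrow> 'b \<Rightarrow> 'k) \<Rightarrow>
     'a set \<Rightarrow> 'b set \<Rightarrow> ('a \<Rightarrow> 'b) set" where
  "weak_range_covering s1 s2 ip2 Y1 Y2 =
     weak_operator_topology s1 s2 ip2 closure_of range_covering s1 s2 Y1 Y2"

(* vector_space.dim is not used because it is 0 for infinite-dimensional subspaces. *)
definition subspaces_of_dim ::
    "('k::field \<Rightarrow> 'a::ab_group_add \<Rightarrow> 'a) \<Rightarrow> nat \<Rightarrow> 'a set set" where
  "subspaces_of_dim s n =
     {module.span s B | B. finite B \<and> card B = n \<and> \<not> module.dependent s B}"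

(* The real-valued SUP is the intended one for nonempty bounded K, and the outer INF when
   n-dimensional subspaces exist; generating ellipsoids in infinite-dimensional spaces satisfy both. *)
definition kolmogorov_width ::
    "('k::field \<Rightarrow> 'a::real_normed_vector \<Rightarrow> 'a) \<Rightarrow> 'a set \<Rightarrow> nat \<Rightarrow> real" where
  "kolmogorov_width s K n =
     (INF X \<in> subspaces_of_dim s n. SUP x \<in> K. INF z \<in> X. norm (x - z))"

definition majorizes :: "(nat \<Rightarrow> real) \<Rightarrow> (nat \<Rightarrow> real) \<Rightarrow> bool" where
  "majorizes a b \<longleftrightarrow> (\<exists>C>0. \<forall>n. b n \<le> C * a n)"

definition seq_equivalent :: "(nat \<Rightarrow> real) \<Rightarrow> (nat \<Rightarrow> real) \<Rightarrow> bool" where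
  "seq_equivalent a b \<longleftrightarrow>
     (\<forall>n. 0 < a n) \<and> (\<forall>n. 0 < b n) \<and> majorizes a b \<and> majorizes b a"

definition left_shift :: "nat \<Rightarrow> (nat \<Rightarrow> real) \<Rightarrow> nat \<Rightarrow> real" where
  "left_shift k a = (\<lambda>n. a (n + k))"

definition generating_ellipsoid ::
    "('k::field \<Rightarrow> 'h::real_normed_vector \<Rightarrow> 'h) \<Rightarrow>
     ('k \<Rightarrow> 'a::real_normed_vector \<Rightarrow> 'a) \<Rightarrow> 'a set \<Rightarrow> 'a set \<Rightarrow> bool" where
  "generating_ellipsoid sH s Y K \<longleftrightarrow>
     (\<exists>A. compact_operator sH s A \<and> infinite_dimensional s (range A) \<and>
          Y = range A \<and> K = A ` cball 0 1)"

(* The class d(Y).  The first argument fixes the domain of the generating operators.  When it is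
   a separable infinite-dimensional Hilbert space this loses no ellipsoid: the orthogonal
   complement of the kernel of a compact operator of infinite rank is again such a space, and
   passing to it does not change the image of the closed unit ball. *)
definition width_class ::
    "('k::field \<Rightarrow> 'h::real_normed_vector \<Rightarrow> 'h) \<Rightarrow>
     ('k \<Rightarrow> 'a::real_normed_vector \<Rightarrow> 'a) \<Rightarrow> 'a set \<Rightarrow> (nat \<Rightarrow> real) set" where
  "width_class sH s Y =
     {a. \<exists>K. generating_ellipsoid sH s Y K \<and> seq_equivalent a (kolmogorov_width s K)}"

(* Majorization and left shifts (written left_shift k ` D) of equivalence classes are taken through
   representatives, on whose choice they do not depend. *)
definition class_majorizes :: "(nat \<Rightarrow> real) set \<Rightarrow> (nat \<Rightarrow> real) set \<Rightarrow> bool" where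
  "class_majorizes D E \<longleftrightarrow> (\<exists>a\<in>D. \<exists>b\<in>E. majorizes a b)"

definition lacunary :: "(nat \<Rightarrow> real) \<Rightarrow> bool" where
  "lacunary a \<longleftrightarrow> decseq a \<and> (\<forall>n. 0 < a n) \<and> a \<longlonglongrightarrow> 0 \<and>
     liminf (\<lambda>n. ereal (a (Suc n) / a n)) = 0"

(* Lacunarity is only defined for non-increasing sequences, while an equivalence class also
   contains others. *)
definition lacunary_class :: "(nat \<Rightarrow> real) set \<Rightarrow> bool" where
  "lacunary_class D \<longleftrightarrow> (\<forall>a\<in>D. decseq a \<longrightarrow> lacunary a)"

(* For subspaces V and W, the cosets of the (distinct) elements of B are a finite basis of the
   image of V in the quotient by W, whose elements are the cosets x +o W. *)
definition finite_basis_modulo ::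
    "('k::field \<Rightarrow> 'a::ab_group_add \<Rightarrow> 'a) \<Rightarrow> 'a set \<Rightarrow> 'a set \<Rightarrow> 'a set \<Rightarrow> bool" where
  "finite_basis_modulo s W V B \<longleftrightarrow>
     finite B \<and> B \<subseteq> V \<and>
     (\<forall>c. (\<Sum>b\<in>B. s (c b) b) +o W = 0 +o W \<longrightarrow> (\<forall>b\<in>B. c b = 0)) \<and>
     (\<lambda>x. x +o W) ` V = (\<lambda>x. x +o W) ` module.span s B"

definition dim_modulo_le ::
    "('k::field \<Rightarrow> 'a::ab_group_add \<Rightarrow> 'a) \<Rightarrow> 'a set \<Rightarrow> 'a set \<Rightarrow> nat \<Rightarrow> bool" where
  "dim_modulo_le s W V k \<longleftrightarrow> (\<exists>B. finite_basis_modulo s W V B \<and> card B \<le> k)"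

end

theory Submission
  imports Defs
begin

text \<open>A compact operator of infinite rank has a singular value decomposition, and the Kolmogorov widths
  of its generating ellipsoid are its singular values. Let \<open>Y1\<close>, \<open>Y2\<close> have orthonormal systems
  \<open>u n\<close>, \<open>v n\<close> and singular values \<open>s n\<close>, \<open>t n\<close>.

  Suppose that \<open>R Y1\<close> contains \<open>Y2\<close> and \<open>m\<close> further vectors independent modulo the closure of \<open>Y2\<close>.
  By a dimension count some nontrivial combination of these vectors and of \<open>v i\<close>, \<open>i \<le> n\<close>, is
  orthogonal to the \<open>n + m\<close> vectors \<open>R (u j)\<close>, \<open>j < n + m\<close>. Comparing its norm with the norm of a
  preimage under \<open>R A1\<close> (open mapping argument) gives \<open>t n \<le> C * s (n + m)\<close>. Independence modulo a
  closed subspace survives small weak perturbations, hence the restriction on weak limits.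

  Conversely let \<open>t n \<le> C * s (n + r)\<close>, and let \<open>v'\<close> be \<open>v\<close> preceded by \<open>r\<close> orthonormal vectors
  orthogonal to \<open>Y2\<close>. The partial isometry \<open>D\<close> taking \<open>u n\<close> to \<open>v' n\<close> maps \<open>Y1\<close> onto a set containing
  \<open>Y2\<close>. Replace its leading block of size \<open>2N\<close> by the block matrix with rows \<open>(B, 1)\<close> and \<open>(1, 0)\<close>, where
  \<open>B\<close> is the compression of \<open>T\<close> to the first \<open>N\<close> coordinates. This matrix is invertible for every \<open>B\<close>, so the
  image of \<open>Y1\<close> does not change, and as \<open>N\<close> grows the new operators converge weakly to the compression
  of \<open>T\<close>. The \<open>r\<close> additional vectors account for the part of \<open>T Y1\<close> outside the closure of \<open>Y2\<close>.\<close>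

subsection \<open>Hilbert spaces over a real or complex scalar field\<close>

lemma scnj_0 [simp]: "scnj (0::'k::rc_field) = 0"
  using scnj_add[of "0::'k" 0] by simp

text \<open>For a nonzero real scalar the axiom \<open>mult_scnj\<close> can be divided by the
  scalar itself.\<close>

lemma scnj_of_real [simp]: "scnj (of_real r :: 'k::rc_field) = of_real r"
proof (cases "r = 0")
  case False
  have "of_real r * scnj (of_real r :: 'k) = of_real r * of_real r"
    using mult_scnj[of "of_real r :: 'k"]
    by (simp add: power2_eq_square scaleR_conv_of_real flip: abs_mult)
  with False show ?thesis by simp
qed simp

lemma mult_scnj': "(x::'k::rc_field) * scnj x = of_real ((norm x)\<^sup>2)"
  by (simp add: mult_scnj scaleR_conv_of_real del: of_real_power)

lemma norm_scnj [simp]: "norm (scnj (x::'k::rc_field)) = norm x"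
proof (cases "x = 0")
  case False
  have "norm x * norm (scnj x) = norm x * norm x"
    using arg_cong[OF mult_scnj'[of x], of norm]
    by (simp add: norm_mult power2_eq_square)
  with False show ?thesis by simp
qed simp

lemma scnj_minus: "scnj (- x) = - scnj (x::'k::rc_field)"
  using scnj_add[of x "-x"] by (simp add: eq_neg_iff_add_eq_0 add.commute)

lemma scnj_diff: "scnj (x - y) = scnj (x::'k::rc_field) - scnj y"
  using scnj_add[of x "-y"] by (simp add: scnj_minus)

context hilbert_space
begin

lemma ip_add_right: "ip x (y + z) = ip x y + ip x z"
  by (metis ip_add_left ip_commute scnj_add)

lemma ip_scale_right: "ip x (scale c y) = scnj c * ip x y"
  by (metis ip_scale_left ip_commute scnj_mult)

lemma ip_zero [simp]: "ip 0 x = 0" "ip x 0 = 0"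
  using ip_add_left[of 0 0 x] ip_add_right[of x 0 0] by auto

lemma ip_minus_left: "ip (- x) y = - ip x y"
  using ip_add_left[of x "-x" y] by (simp add: eq_neg_iff_add_eq_0 add.commute)

lemma ip_diff_left: "ip (x - y) z = ip x z - ip y z"
  using ip_add_left[of x "-y" z] by (simp add: ip_minus_left)

lemma ip_diff_right: "ip x (y - z) = ip x y - ip x z"
  by (metis ip_diff_left ip_commute scnj_diff)

lemma ip_sum_left: "ip (sum f A) y = (\<Sum>i\<in>A. ip (f i) y)"
  by (induction A rule: infinite_finite_induct) (auto simp: ip_add_left)

lemma ip_sum_right: "ip x (sum f A) = (\<Sum>i\<in>A. ip x (f i))"
  by (induction A rule: infinite_finite_induct) (auto simp: ip_add_right)

lemma ip_eq_0_commute: "ip x y = 0 \<longleftrightarrow> ip y x = 0"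
  by (metis ip_commute scnj_0)

lemma norm_scale: "norm (scale c x) = norm c * norm x"
proof -
  have "(of_real ((norm (scale c x))\<^sup>2) :: 'k) = of_real ((norm c * norm x)\<^sup>2)"
  proof -
    have "ip (scale c x) (scale c x) = (c * scnj c) * ip x x"
      by (simp add: ip_scale_left ip_scale_right)
    then show ?thesis
      by (simp only: ip_self mult_scnj' power_mult_distrib of_real_mult)
  qed
  then have "(norm (scale c x))\<^sup>2 = (norm c * norm x)\<^sup>2"
    by (simp only: of_real_eq_iff)
  then show ?thesis by (simp add: power2_eq_iff_nonneg)
qed

lemma norm_add_sq: "of_real ((norm (x + y))\<^sup>2) = of_real ((norm x)\<^sup>2) + of_real ((norm y)\<^sup>2) + ip x y + ip y x"
  by (simp only: ip_self[symmetric] ip_add_left ip_add_right) simp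

lemma pythagoras:
  assumes "ip x y = 0"
  shows "(norm (x + y))\<^sup>2 = (norm x)\<^sup>2 + (norm y)\<^sup>2"
proof -
  have "(of_real ((norm (x + y))\<^sup>2) :: 'k) = of_real ((norm x)\<^sup>2 + (norm y)\<^sup>2)"
    using norm_add_sq[of x y] assms ip_eq_0_commute[of x y] by (simp del: of_real_power)
  then show ?thesis by (simp only: of_real_eq_iff)
qed

text \<open>Cauchy-Schwarz over the scalar field: after subtracting from \<open>x\<close> its
  component along \<open>y\<close> the remainder is orthogonal to \<open>y\<close>, so by Pythagoras
  that component is no longer than \<open>x\<close>.\<close>

lemma norm_ip_le: "norm (ip x y) \<le> norm x * norm y"
proof (cases "y = 0")
  case False
  define c where "c = ip x y / of_real ((norm y)\<^sup>2)"
  have c: "c * of_real ((norm y)\<^sup>2) = ip x y"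
    using False by (simp add: c_def)
  have "ip (x - scale c y) (scale c y) = 0"
    by (simp add: ip_scale_right ip_diff_left ip_scale_left ip_self c del: of_real_power)
  from pythagoras[OF this] have "(norm (scale c y))\<^sup>2 \<le> (norm x)\<^sup>2" by simp
  then have "norm c * norm y \<le> norm x"
    unfolding norm_scale by (rule power2_le_imp_le) simp
  moreover have "norm c * (norm y)\<^sup>2 = norm (ip x y)"
    using arg_cong[OF c, of norm] by (simp add: norm_mult norm_power)
  ultimately show ?thesis
    using mult_right_mono[of "norm c * norm y" "norm x" "norm y"]
    by (simp add: power2_eq_square mult.assoc)
qed simp

lemma ip_scaleR_left: "ip (r *\<^sub>R x) y = r *\<^sub>R ip x y"
  by (simp add: scale_of_real[symmetric] ip_scale_left scaleR_conv_of_real)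

lemma ip_scaleR_right: "ip x (r *\<^sub>R y) = r *\<^sub>R ip x y"
  by (simp add: scale_of_real[symmetric] ip_scale_right scaleR_conv_of_real)

text \<open>Over the reals \<open>ip\<close> is bilinear even though it is conjugate-linear in the
  second argument, so continuity and limits follow from the general theory of bounded bilinear
  maps.\<close>

lemma bounded_bilinear_ip: "bounded_bilinear ip"
  by (rule bounded_bilinear.intro)
    (auto simp: ip_add_left ip_add_right ip_scaleR_left ip_scaleR_right intro!: exI[of _ 1] norm_ip_le)

lemmas bounded_linear_ip_left = bounded_bilinear.bounded_linear_left[OF bounded_bilinear_ip]
lemmas tendsto_ip = bounded_bilinear.tendsto[OF bounded_bilinear_ip]

lemma scale_scaleR: "scale c (r *\<^sub>R x) = r *\<^sub>R scale c x"
  by (metis scale_of_real scale_left_commute)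

lemma bounded_bilinear_scale: "bounded_bilinear scale"
proof (rule bounded_bilinear.intro)
  show "scale (r *\<^sub>R c) x = r *\<^sub>R scale c x" for r c x
    by (simp add: scaleR_conv_of_real scale_of_real[symmetric])
  show "\<exists>K. \<forall>a b. norm (scale a b) \<le> norm a * norm b * K"
    by (auto simp: norm_scale intro!: exI[of _ 1])
qed (simp_all add: scale_left_distrib scale_right_distrib scale_scaleR)

section \<open>Orthonormal families and finite orthogonal projections\<close>

definition orthonormal :: "nat set \<Rightarrow> (nat \<Rightarrow> 'a) \<Rightarrow> bool" where
  "orthonormal I e \<longleftrightarrow> (\<forall>i\<in>I. \<forall>j\<in>I. ip (e i) (e j) = of_bool (i = j))"

lemma orthonormalD: "orthonormal I e \<Longrightarrow> i \<in> I \<Longrightarrow> j \<in> I \<Longrightarrow> ip (e i) (e j) = of_bool (i = j)"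
  by (auto simp: orthonormal_def)

lemma orthonormal_mono: "orthonormal I e \<Longrightarrow> J \<subseteq> I \<Longrightarrow> orthonormal J e"
  by (auto simp: orthonormal_def subset_iff)

lemma orthonormal_norm: "orthonormal I e \<Longrightarrow> i \<in> I \<Longrightarrow> norm (e i) = 1"
proof -
  assume "orthonormal I e" "i \<in> I"
  then have "(of_real ((norm (e i))\<^sup>2) :: 'k) = of_real 1"
    using orthonormalD[of I e i i] ip_self[of "e i"] by simp
  then have "(norm (e i))\<^sup>2 = 1" by (simp only: of_real_eq_iff)
  then show ?thesis by (simp add: power2_eq_1_iff) (smt (verit) norm_ge_zero)
qed

lemma ip_sum_orthonormal:
  assumes "orthonormal J e" "I \<subseteq> J" "finite I" "j \<in> J"
  shows "ip (\<Sum>i\<in>I. scale (c i) (e i)) (e j) = (if j \<in> I then c j else 0)"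
proof -
  have "ip (\<Sum>i\<in>I. scale (c i) (e i)) (e j) = (\<Sum>i\<in>I. c i * of_bool (i = j))"
    using assms by (auto simp: ip_sum_left ip_scale_left orthonormalD[OF assms(1)] subset_iff intro!: sum.cong)
  also have "\<dots> = (\<Sum>i\<in>I. if i = j then c i else 0)"
    by (intro sum.cong) auto
  also have "\<dots> = (if j \<in> I then c j else 0)"
    using assms by simp
  finally show ?thesis .
qed

lemma norm_sum_orthonormal:
  assumes "orthonormal I e" "finite I"
  shows "(norm (\<Sum>i\<in>I. scale (c i) (e i)))\<^sup>2 = (\<Sum>i\<in>I. (norm (c i))\<^sup>2)"
proof -
  have "(of_real ((norm (\<Sum>i\<in>I. scale (c i) (e i)))\<^sup>2) :: 'k)
      = (\<Sum>j\<in>I. scnj (c j) * ip (\<Sum>i\<in>I. scale (c i) (e i)) (e j))"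
    by (simp only: ip_self[symmetric] ip_sum_right ip_scale_right)
  also have "\<dots> = (\<Sum>j\<in>I. scnj (c j) * c j)"
    using assms by (intro sum.cong) (auto simp: ip_sum_orthonormal[OF assms(1) subset_refl])
  also have "\<dots> = of_real (\<Sum>i\<in>I. (norm (c i))\<^sup>2)"
    by (simp add: mult_scnj' mult.commute[of "scnj _"] del: of_real_power)
  finally show ?thesis by (simp only: of_real_eq_iff)
qed

definition proj :: "nat set \<Rightarrow> (nat \<Rightarrow> 'a) \<Rightarrow> 'a \<Rightarrow> 'a" where
  "proj I e x = (\<Sum>i\<in>I. scale (ip x (e i)) (e i))"

lemma proj_residual_orth:
  assumes "orthonormal I e" "finite I" "j \<in> I"
  shows "ip (x - proj I e x) (e j) = 0"
  using ip_sum_orthonormal[OF assms(1) subset_refl assms(2,3)] assms(3)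
  by (simp add: ip_diff_left proj_def)

lemma proj_pythagoras:
  assumes "orthonormal I e" "finite I"
  shows "(norm x)\<^sup>2 = (norm (x - proj I e x))\<^sup>2 + (norm (proj I e x))\<^sup>2"
proof -
  have "ip (x - proj I e x) (proj I e x) = 0"
    by (subst (2) proj_def) (simp add: ip_sum_right ip_scale_right proj_residual_orth[OF assms])
  from pythagoras[OF this] show ?thesis by simp
qed

lemma norm_proj_le: "orthonormal I e \<Longrightarrow> finite I \<Longrightarrow> norm (proj I e x) \<le> norm x"
  by (rule power2_le_imp_le) (use proj_pythagoras[of I e x] in auto)

lemma norm_proj_residual_le: "orthonormal I e \<Longrightarrow> finite I \<Longrightarrow> norm (x - proj I e x) \<le> norm x"
  by (rule power2_le_imp_le) (use proj_pythagoras[of I e x] in auto)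

lemma bessel:
  assumes "orthonormal I e" "finite I"
  shows "(\<Sum>i\<in>I. (norm (ip x (e i)))\<^sup>2) \<le> (norm x)\<^sup>2"
  using norm_sum_orthonormal[OF assms, of "\<lambda>i. ip x (e i)"] proj_pythagoras[OF assms, of x]
  by (simp add: proj_def)

lemma proj_diff: "proj I e (x - y) = proj I e x - proj I e y"
  by (simp add: proj_def ip_diff_left scale_left_diff_distrib sum_subtractf)

text \<open>Each new vector is replaced by its normalized residual after projection onto the earlier
  ones, and skipped if the residual is zero. Since \<open>B\<close> may be dependent,
  \<open>n\<close> can be smaller than \<open>card B\<close>.\<close>

lemma gram_schmidt:
  assumes "finite B"
  shows "\<exists>n w. n \<le> card B \<and> orthonormal {..<n} w \<and> span (w ` {..<n}) = span B"
  using assms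
proof (induction B)
  case empty
  then show ?case by (intro exI[of _ 0]) (auto simp: orthonormal_def)
next
  case (insert b B)
  then obtain n w where nw: "n \<le> card B" "orthonormal {..<n} w" "span (w ` {..<n}) = span B"
    by blast
  define r where "r = b - proj {..<n} w b"
  have p: "proj {..<n} w b \<in> span (w ` {..<n})"
    unfolding proj_def by (intro span_sum span_scale span_base) auto
  have sp: "span (insert r (w ` {..<n})) = span (insert b B)"
  proof -
    have "span (insert r (w ` {..<n})) = span (insert b (w ` {..<n}))"
      using p eq_span_insert_eq[of b r "w ` {..<n}"] by (simp add: r_def)
    also have "\<dots> = span (insert b B)"
      using nw(3) by (simp add: span_insert)
    finally show ?thesis .
  qed
  show ?case
  proof (cases "r = 0")
    case True
    then have "span (w ` {..<n}) = span (insert b B)"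
      using sp by (simp add: span_insert_0)
    then show ?thesis using nw insert.hyps by (intro exI[of _ n] exI[of _ w]) auto
  next
    case False
    define w' where "w' = w(n := scale (of_real (1 / norm r)) r)"
    have r0: "ip r (w j) = 0" if "j < n" for j
      using proj_residual_orth[OF nw(2), of j b] that by (simp add: r_def)
    have "ip (w' n) (w' n) = 1"
      using False ip_self[of "w' n"] by (simp add: w'_def norm_scale norm_divide)
    moreover have "ip (w' n) (w j) = 0" "ip (w j) (w' n) = 0" if "j < n" for j
      using r0[OF that] ip_eq_0_commute[of r "w j"]
      by (auto simp: w'_def ip_scale_left ip_scale_right)
    ultimately have "orthonormal {..<Suc n} w'"
      using nw(2) by (auto simp: orthonormal_def less_Suc_eq w'_def)
    moreover have "span (w' ` {..<Suc n}) = span (insert b B)"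
    proof -
      have "w' ` {..<Suc n} = insert (scale (of_real (1 / norm r)) r) (w ` {..<n})"
        by (auto simp: w'_def lessThan_Suc)
      moreover have "span (insert (scale (of_real (1 / norm r)) r) (w ` {..<n})) = span (insert r (w ` {..<n}))"
      proof -
        let ?c = "of_real (1 / norm r) :: 'k"
        have "r = scale (of_real (norm r)) (scale ?c r)"
          using False by simp
        then have "r \<in> span (insert (scale ?c r) (w ` {..<n}))"
          by (metis insertI1 span_base span_scale)
        moreover have "scale ?c r \<in> span (insert r (w ` {..<n}))"
          by (intro span_scale span_base) simp
        ultimately show ?thesis
          by (metis insert_subset span_eq span_superset)
      qed
      ultimately show ?thesis using sp by simp
    qed
    ultimately show ?thesis using nw(1) insert.hyps
      by (intro exI[of _ "Suc n"] exI[of _ w']) auto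
  qed
qed

end

subsection \<open>Bounded operators\<close>

locale hilbert_pair = H1: hilbert_space s1 ip1 + H2: hilbert_space s2 ip2
  for s1 :: "'k::rc_field \<Rightarrow> 'a::{real_inner, banach} \<Rightarrow> 'a" and ip1
    and s2 :: "'k \<Rightarrow> 'b::{real_inner, banach} \<Rightarrow> 'b" and ip2
begin

lemma bounded_operatorsI:
  assumes "\<And>x y. T (x + y) = T x + T y" "\<And>c x. T (s1 c x) = s2 c (T x)"
    and "\<And>x. norm (T x) \<le> norm x * K"
  shows "T \<in> bounded_operators s1 s2"
proof -
  have "Vector_Spaces.linear s1 s2 T"
    using assms(1,2) H1.vector_space_axioms H2.vector_space_axioms
    by (simp add: Vector_Spaces.linear_iff)
  moreover have "bounded_linear T"
    using assms(2)[of "of_real _"] assms(1,3)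
    by (intro bounded_linear_intro[of _ K]) (auto simp: H1.scale_of_real H2.scale_of_real)
  ultimately show ?thesis by (simp add: bounded_operators_def)
qed

lemma
  assumes "T \<in> bounded_operators s1 s2"
  shows bo_add: "T (x + y) = T x + T y" and bo_scale: "T (s1 c x) = s2 c (T x)"
    and bo_bounded_linear: "bounded_linear T"
  using assms by (auto simp: bounded_operators_def Vector_Spaces.linear_iff)

lemma bo_zero: "T \<in> bounded_operators s1 s2 \<Longrightarrow> T 0 = 0"
  using bo_bounded_linear linear_simps(3) by blast

lemma bo_diff: "T \<in> bounded_operators s1 s2 \<Longrightarrow> T (x - y) = T x - T y"
  using bo_bounded_linear linear_simps(2) by blast

lemma bo_sum: "T \<in> bounded_operators s1 s2 \<Longrightarrow> T (sum f A) = (\<Sum>i\<in>A. T (f i))"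
  by (induction A rule: infinite_finite_induct) (auto simp: bo_zero bo_add)

lemma bo_bound:
  assumes "T \<in> bounded_operators s1 s2"
  obtains K where "K > 0" "\<And>x. norm (T x) \<le> K * norm x"
  using bounded_linear.pos_bounded[OF bo_bounded_linear[OF assms]] by (metis mult.commute)

lemma bounded_operators_add:
  assumes "S \<in> bounded_operators s1 s2" "T \<in> bounded_operators s1 s2"
  shows "(\<lambda>x. S x + T x) \<in> bounded_operators s1 s2"
proof -
  have "bounded_linear (\<lambda>x. S x + T x)"
    using assms by (intro bounded_linear_add bo_bounded_linear)
  with bo_scale[OF assms(1)] bo_scale[OF assms(2)] bo_add[OF assms(1)] bo_add[OF assms(2)]
  show ?thesis
    using H1.vector_space_axioms H2.vector_space_axioms
    by (auto simp: bounded_operators_def Vector_Spaces.linear_iff H2.scale_right_distrib)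
qed

lemma bounded_operators_diff:
  assumes "S \<in> bounded_operators s1 s2" "T \<in> bounded_operators s1 s2"
  shows "(\<lambda>x. S x - T x) \<in> bounded_operators s1 s2"
proof -
  have "bounded_linear (\<lambda>x. S x - T x)"
    using assms by (intro bounded_linear_sub bo_bounded_linear)
  with bo_scale[OF assms(1)] bo_scale[OF assms(2)] bo_add[OF assms(1)] bo_add[OF assms(2)]
  show ?thesis
    using H1.vector_space_axioms H2.vector_space_axioms
    by (auto simp: bounded_operators_def Vector_Spaces.linear_iff H2.scale_right_diff_distrib)
qed

lemma bounded_operators_sum:
  assumes "\<And>i. i \<in> I \<Longrightarrow> F i \<in> bounded_operators s1 s2"
  shows "(\<lambda>x. \<Sum>i\<in>I. F i x) \<in> bounded_operators s1 s2"
  using assms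
proof (induction I rule: infinite_finite_induct)
  case (insert i I)
  then show ?case by (simp add: bounded_operators_add)
qed (auto intro!: bounded_operatorsI[of _ 0])

lemma bounded_operators_rank_one: "(\<lambda>x. s2 (ip1 x u) v) \<in> bounded_operators s1 s2"
proof (rule bounded_operatorsI)
  show "norm (s2 (ip1 x u) v) \<le> norm x * (norm u * norm v)" for x
    using mult_right_mono[OF H1.norm_ip_le[of x u], of "norm v"]
    by (simp add: H2.norm_scale mult.assoc)
qed (simp_all add: H1.ip_add_left H1.ip_scale_left H2.scale_left_distrib)

text \<open>By orthonormality of \<open>f\<close> the squared norm of a block of the series is a
  block of a numerical series, and Bessel's inequality for \<open>e\<close> makes the latter
  converge.\<close>

lemma diagonal_summable:
  assumes e: "H1.orthonormal UNIV e" and f: "H2.orthonormal UNIV f"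
    and m: "\<And>n. norm (m n) \<le> C"
  shows "summable (\<lambda>n. s2 (m n * ip1 x (e n)) (f n))"
proof -
  have b: "(\<Sum>i<n. (norm (ip1 x (e i)))\<^sup>2) \<le> (norm x)\<^sup>2" for n
    using H1.bessel[OF H1.orthonormal_mono[OF e], of "{..<n}" x] by simp
  have "summable (\<lambda>i. (norm (ip1 x (e i)))\<^sup>2)"
    by (rule summableI_nonneg_bounded[OF _ b]) auto
  then have "summable (\<lambda>i. C\<^sup>2 * (norm (ip1 x (e i)))\<^sup>2)" by (rule summable_mult)
  then have sm: "summable (\<lambda>i. (norm (m i * ip1 x (e i)))\<^sup>2)"
    by (rule summable_comparison_test')
      (auto simp: norm_mult power_mult_distrib intro!: mult_right_mono power_mono m)
  show ?thesis
    unfolding summable_Cauchy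
  proof (intro allI impI)
    fix r :: real assume r: "r > 0"
    then have "r\<^sup>2 > 0" by simp
    with sm obtain N where N: "\<And>p q. p \<ge> N \<Longrightarrow> norm (\<Sum>i=p..<q. (norm (m i * ip1 x (e i)))\<^sup>2) < r\<^sup>2"
      unfolding summable_Cauchy by blast
    have "norm (\<Sum>i=p..<q. s2 (m i * ip1 x (e i)) (f i)) < r" if "p \<ge> N" for p q
    proof -
      have "(norm (\<Sum>i=p..<q. s2 (m i * ip1 x (e i)) (f i)))\<^sup>2 < r\<^sup>2"
        using N[OF that, of q] H2.norm_sum_orthonormal[OF H2.orthonormal_mono[OF f], of "{p..<q}"]
        by (simp add: sum_nonneg)
      then show ?thesis using r by (rule power2_less_imp_less[OF _ less_imp_le])
    qed
    then show "\<exists>N. \<forall>p\<ge>N. \<forall>q. norm (\<Sum>i=p..<q. s2 (m i * ip1 x (e i)) (f i)) < r" by blast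
  qed
qed

text \<open>With the constant multiplier 1 this yields the partial isometry taking
  \<open>e n\<close> to \<open>f n\<close> and, for \<open>e = f\<close>, the orthogonal projection
  onto the closed span.\<close>

lemma diagonal_operator:
  assumes e: "H1.orthonormal UNIV e" and f: "H2.orthonormal UNIV f"
    and m: "\<And>n. norm (m n) \<le> C"
  obtains D where "D \<in> bounded_operators s1 s2"
    "\<And>x. (\<lambda>n. s2 (m n * ip1 x (e n)) (f n)) sums D x"
proof -
  define D where "D x = (\<Sum>n. s2 (m n * ip1 x (e n)) (f n))" for x
  have D: "(\<lambda>n. s2 (m n * ip1 x (e n)) (f n)) sums D x" for x
    unfolding D_def using diagonal_summable[OF assms] by (rule summable_sums)
  have C: "C \<ge> 0" using m[of 0] norm_ge_zero order_trans by blast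
  have "D \<in> bounded_operators s1 s2"
  proof (rule bounded_operatorsI)
    fix x y c
    have "(\<lambda>n. s2 (m n * ip1 x (e n)) (f n) + s2 (m n * ip1 y (e n)) (f n)) sums (D x + D y)"
      by (intro sums_add D)
    then show "D (x + y) = D x + D y"
      using D[of "x + y"] sums_unique2
      by (fastforce simp: H1.ip_add_left distrib_left H2.scale_left_distrib)
    have "(\<lambda>n. s2 c (s2 (m n * ip1 x (e n)) (f n))) sums s2 c (D x)"
      by (intro bounded_linear.sums[OF bounded_bilinear.bounded_linear_right[OF H2.bounded_bilinear_scale]] D)
    then show "D (s1 c x) = s2 c (D x)"
      using D[of "s1 c x"] sums_unique2
      by (fastforce simp: H1.ip_scale_left mult.left_commute)
  next
    fix x
    have "norm (\<Sum>i<n. s2 (m i * ip1 x (e i)) (f i)) \<le> norm x * C" for n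
    proof (rule power2_le_imp_le)
      have "(norm (\<Sum>i<n. s2 (m i * ip1 x (e i)) (f i)))\<^sup>2 = (\<Sum>i<n. (norm (m i * ip1 x (e i)))\<^sup>2)"
        by (rule H2.norm_sum_orthonormal[OF H2.orthonormal_mono[OF f]]) auto
      also have "\<dots> \<le> (\<Sum>i<n. C\<^sup>2 * (norm (ip1 x (e i)))\<^sup>2)"
        by (intro sum_mono) (auto simp: norm_mult power_mult_distrib intro!: mult_right_mono power_mono m)
      also have "\<dots> \<le> C\<^sup>2 * (norm x)\<^sup>2"
        using H1.bessel[OF H1.orthonormal_mono[OF e], of "{..<n}" x]
        by (simp add: sum_distrib_left[symmetric] mult_left_mono)
      finally show "(norm (\<Sum>i<n. s2 (m i * ip1 x (e i)) (f i)))\<^sup>2 \<le> (norm x * C)\<^sup>2"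
        by (simp add: power_mult_distrib mult.commute)
    qed (use C in auto)
    then show "norm (D x) \<le> norm x * C"
      using D[of x, unfolded sums_def] by (intro LIMSEQ_le_const2[OF tendsto_norm]) auto
  qed
  with D that show thesis by blast
qed

text \<open>Compactness makes the images of a maximizing sequence converge along a subsequence, and
  uniform convexity of the norm then makes the vectors themselves converge. The hypotheses on
  \<open>S\<close> describe a closed subspace on which \<open>A\<close> is not identically
  zero.\<close>

lemma norm_attained:
  assumes A: "A \<in> bounded_operators s1 s2" and cpt: "compact (closure (A ` cball 0 1))"
    and scl: "\<And>c x. x \<in> S \<Longrightarrow> s1 c x \<in> S" and add: "\<And>x y. x \<in> S \<Longrightarrow> y \<in> S \<Longrightarrow> x + y \<in> S"
    and S: "closed S" and nz: "z0 \<in> S" "A z0 \<noteq> 0"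
  obtains x where "x \<in> S" "norm x = 1" "\<And>z. z \<in> S \<Longrightarrow> norm (A z) \<le> norm (A x) * norm z"
proof -
  define N where "N = (\<lambda>z. norm (A z)) ` {z \<in> S. norm z = 1}"
  define M where "M = Sup N"
  obtain K where K: "K > 0" "\<And>x. norm (A x) \<le> K * norm x" using bo_bound[OF A] by blast
  have bdd: "bdd_above N" unfolding N_def using K(2) by (intro bdd_aboveI2[of _ _ K]) (metis (mono_tags) mem_Collect_eq mult.right_neutral)
  have normalize: "s1 (of_real (inverse (norm z))) z \<in> {z \<in> S. norm z = 1}" if "z \<in> S" "z \<noteq> 0" for z
    using that by (auto simp: scl H1.norm_scale norm_inverse)
  have M: "norm (A z) \<le> M * norm z" if "z \<in> S" for z
  proof (cases "z = 0")
    case False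
    have "norm (A (s1 (of_real (inverse (norm z))) z)) \<le> M"
      unfolding M_def N_def using normalize[OF that False] bdd[unfolded N_def]
      by (intro cSUP_upper) auto
    then show ?thesis using False
      by (simp add: bo_scale[OF A] H2.norm_scale norm_divide field_simps)
  qed (simp add: bo_zero[OF A])
  have z0: "z0 \<noteq> 0" using nz bo_zero[OF A] by auto
  have M0: "M > 0"
    using M[OF nz(1)] nz(2) z0 by (metis norm_ge_zero zero_less_norm_iff less_le_trans zero_less_mult_pos2)
  have ne: "N \<noteq> {}" using normalize[OF nz(1) z0] by (auto simp: N_def)
  have "\<forall>n. \<exists>x. x \<in> S \<and> norm x = 1 \<and> M - inverse (real (Suc n)) < norm (A x)"
  proof
    fix n
    have "M - inverse (real (Suc n)) < Sup N" by (simp add: M_def)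
    from less_cSupD[OF ne this]
    show "\<exists>x. x \<in> S \<and> norm x = 1 \<and> M - inverse (real (Suc n)) < norm (A x)" by (auto simp: N_def)
  qed
  from choice[OF this] obtain x
    where "\<forall>n. x n \<in> S \<and> norm (x n) = 1 \<and> M - inverse (real (Suc n)) < norm (A (x n))" ..
  then have x: "\<And>n. x n \<in> S" "\<And>n. norm (x n) = 1"
    "\<And>n. M - inverse (real (Suc n)) < norm (A (x n))" by auto
  have "\<forall>n. A (x n) \<in> closure (A ` cball 0 1)"
    using x(2) by (intro allI subsetD[OF closure_subset] imageI) simp
  from seq_compactE[OF cpt[unfolded compact_eq_seq_compact_metric] this]
  obtain y r where r: "strict_mono r" "(\<lambda>n. A (x (r n))) \<longlonglongrightarrow> y"
    unfolding o_def by metis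
  have "(\<lambda>n. norm (A (x n))) \<longlonglongrightarrow> M"
  proof (rule tendsto_sandwich)
    show "(\<lambda>n. M - inverse (real (Suc n))) \<longlonglongrightarrow> M"
      using tendsto_diff[OF tendsto_const[of M] LIMSEQ_inverse_real_of_nat] by simp
    show "\<forall>\<^sub>F n in sequentially. norm (A (x n)) \<le> M"
      using M[OF x(1)] x(2) by simp
  qed (use x(3) in \<open>auto intro!: always_eventually less_imp_le\<close>)
  from LIMSEQ_subseq_LIMSEQ[OF this r(1)] have "(\<lambda>n. norm (A (x (r n)))) \<longlonglongrightarrow> M"
    by (simp add: o_def)
  with tendsto_norm[OF r(2)] have y: "norm y = M" using LIMSEQ_unique by blast
  \<comment> \<open>By the parallelogram law a maximizing sequence whose images converge is Cauchy.\<close>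
  have "Cauchy (\<lambda>n. x (r n))"
  proof (rule metric_CauchyI)
    fix \<epsilon> :: real assume \<epsilon>: "\<epsilon> > 0"
    \<comment> \<open>If two images lie within \<open>\<delta>\<close> of \<open>y\<close>, the sum
      of the two unit vectors has norm at least \<open>2 * (M - \<delta>) / M\<close>, and the
      expression here bounds the square of their distance. It vanishes in the limit.\<close>
    have "((\<lambda>\<delta>. 4 - (2 * (M - \<delta>) / M)\<^sup>2) \<longlongrightarrow> 4 - (2 * (M - 0) / M)\<^sup>2) (at_right 0)"
      using M0 by (intro tendsto_intros) auto
    then have "\<forall>\<^sub>F \<delta> in at_right (0::real). 4 - (2 * (M - \<delta>) / M)\<^sup>2 < \<epsilon>\<^sup>2"
      using M0 \<epsilon> by (intro order_tendstoD) (auto simp: field_simps)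
    moreover have "\<forall>\<^sub>F \<delta> in at_right (0::real). 0 < \<delta> \<and> \<delta> < M"
      using M0 eventually_at_right_less[of "0::real"] eventually_at_right_real[of 0 M]
      by (auto elim: eventually_mono)
    ultimately have "\<forall>\<^sub>F \<delta> in at_right (0::real). 4 - (2 * (M - \<delta>) / M)\<^sup>2 < \<epsilon>\<^sup>2 \<and> 0 < \<delta> \<and> \<delta> < M"
      by eventually_elim auto
    then obtain \<delta> where \<delta>: "4 - (2 * (M - \<delta>) / M)\<^sup>2 < \<epsilon>\<^sup>2" "0 < \<delta>" "\<delta> < M"
      using eventually_happens[of _ "at_right (0::real)"] trivial_limit_at_right_real by blast
    obtain n0 where n0: "\<And>n. n \<ge> n0 \<Longrightarrow> dist (A (x (r n))) y < \<delta>"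
      using r(2) \<delta>(2) unfolding lim_sequentially by blast
    show "\<exists>n0. \<forall>m\<ge>n0. \<forall>n\<ge>n0. dist (x (r m)) (x (r n)) < \<epsilon>"
    proof (intro exI allI impI)
      fix m n assume mn: "m \<ge> n0" "n \<ge> n0"
      let ?x = "x (r m)" and ?y = "x (r n)"
      have "2 * M = norm ((y - A ?x) + (y - A ?y) + A (?x + ?y))"
        using y by (simp add: bo_add[OF A] flip: mult_2_right scaleR_2)
      also have "\<dots> \<le> norm (y - A ?x) + norm (y - A ?y) + norm (A (?x + ?y))"
        by (meson add_mono norm_triangle_ineq order_refl order_trans)
      also have "\<dots> \<le> 2 * \<delta> + M * norm (?x + ?y)"
        using n0[OF mn(1)] n0[OF mn(2)] M[OF add[OF x(1) x(1)]]
        by (simp add: dist_norm norm_minus_commute add_mono)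
      finally have "2 * (M - \<delta>) / M \<le> norm (?x + ?y)"
        using M0 by (simp add: field_simps)
      then have "(2 * (M - \<delta>) / M)\<^sup>2 \<le> (norm (?x + ?y))\<^sup>2"
        using \<delta> M0 by (intro power_mono) auto
      moreover have "(norm (?x + ?y))\<^sup>2 + (norm (?x - ?y))\<^sup>2 = 4"
        using x(2)[of "r m"] x(2)[of "r n"]
        by (simp add: power2_norm_eq_inner inner_add_left inner_add_right inner_diff_left
            inner_diff_right inner_commute norm_eq_1)
      ultimately have "(norm (?x - ?y))\<^sup>2 < \<epsilon>\<^sup>2" using \<delta>(1) by linarith
      then show "dist ?x ?y < \<epsilon>"
        using \<epsilon> by (simp add: dist_norm power2_less_imp_less)
    qed
  qed
  then obtain l where l: "(\<lambda>n. x (r n)) \<longlonglongrightarrow> l" by (auto simp: Cauchy_convergent_iff convergent_def)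
  have "l \<in> S" using S l x(1) closed_sequentially[of S "\<lambda>n. x (r n)" l] by blast
  moreover have "norm l = 1" using tendsto_norm[OF l] x(2) by (simp add: LIMSEQ_const_iff)
  moreover have "A l = y"
    using LIMSEQ_unique[OF bounded_linear.tendsto[OF bo_bounded_linear[OF A] l] r(2)] .
  ultimately show thesis using that[of l] M y by auto
qed

text \<open>A variational argument. Moving \<open>x\<close> along \<open>z\<close> by
  \<open>r\<close> times the pairing of \<open>A x\<close> with \<open>A z\<close> would raise the
  squared norm of the image to first order in \<open>r\<close>, whereas orthogonality of
  \<open>x\<close> and \<open>z\<close> lets the admissible bound grow only to second order.\<close>

lemma maximizer_orthogonal:
  assumes A: "A \<in> bounded_operators s1 s2" and x: "norm x = 1" "ip1 x z = 0"
    and max: "\<And>c. norm (A (x + s1 c z)) \<le> norm (A x) * norm (x + s1 c z)"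
  shows "ip2 (A x) (A z) = 0"
proof (rule ccontr)
  let ?M = "norm (A x)"
  define c where "c = ip2 (A x) (A z)"
  assume "ip2 (A x) (A z) \<noteq> 0"
  then have c0: "norm c > 0" by (simp add: c_def)
  have *: "2 * r * (norm c)\<^sup>2 \<le> r\<^sup>2 * ((norm c)\<^sup>2 * (?M * norm z)\<^sup>2)" for r :: real
  proof -
    let ?d = "of_real r * c"
    have "ip2 (A x) (s2 ?d (A z)) = of_real (r * (norm c)\<^sup>2)"
      "ip2 (s2 ?d (A z)) (A x) = of_real (r * (norm c)\<^sup>2)"
      using H2.ip_commute[of "A z" "A x"] mult_scnj'[of c]
      by (simp_all add: H2.ip_scale_left H2.ip_scale_right c_def[symmetric] scnj_mult mult.commute mult.assoc del: of_real_power)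
    then have "(of_real ((norm (A x + s2 ?d (A z)))\<^sup>2) :: 'k)
       = of_real (?M\<^sup>2 + (norm (s2 ?d (A z)))\<^sup>2 + 2 * r * (norm c)\<^sup>2)"
      by (simp add: H2.norm_add_sq algebra_simps del: of_real_power)
    then have "(norm (A x + s2 ?d (A z)))\<^sup>2 = ?M\<^sup>2 + (norm (s2 ?d (A z)))\<^sup>2 + 2 * r * (norm c)\<^sup>2"
      by (simp only: of_real_eq_iff)
    then have "?M\<^sup>2 + 2 * r * (norm c)\<^sup>2 \<le> (norm (A (x + s1 ?d z)))\<^sup>2"
      by (simp add: bo_add[OF A] bo_scale[OF A])
    also have "\<dots> \<le> (?M * norm (x + s1 ?d z))\<^sup>2"
      using max by (intro power_mono) auto
    also have "\<dots> = ?M\<^sup>2 * (1 + (norm (s1 ?d z))\<^sup>2)"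
      using H1.pythagoras[of x "s1 ?d z"] x by (simp add: H1.ip_scale_right power_mult_distrib)
    also have "\<dots> = ?M\<^sup>2 + r\<^sup>2 * ((norm c)\<^sup>2 * (?M * norm z)\<^sup>2)"
      by (simp add: H1.norm_scale norm_mult power_mult_distrib algebra_simps)
    finally show ?thesis by simp
  qed
  \<comment> \<open>At \<open>r = 1 / k\<close> the inequality would give
    \<open>2 / k \<le> 1 / k\<close>.\<close>
  define k where "k = (?M * norm z)\<^sup>2 + 1"
  have k: "k > 0" by (simp add: k_def add_nonneg_pos)
  have "2 * (1 / k) \<le> (1 / k)\<^sup>2 * (?M * norm z)\<^sup>2"
  proof -
    have "(norm c)\<^sup>2 * (2 * (1 / k)) \<le> (norm c)\<^sup>2 * ((1 / k)\<^sup>2 * (?M * norm z)\<^sup>2)"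
      using *[of "1 / k"] by (simp only: mult.left_commute mult.commute)
    then show ?thesis using c0 by (simp only: mult_le_cancel_left_pos zero_less_power)
  qed
  also have "\<dots> \<le> (1 / k)\<^sup>2 * k" by (intro mult_left_mono) (auto simp: k_def)
  finally show False using k by (simp add: field_simps power2_eq_square)
qed

end

subsection \<open>Singular values and Kolmogorov widths\<close>

text \<open>Gaussian elimination: if the last equation has a pivot, its unknown is eliminated from
  the others. Columns have an arbitrary index type because a disjoint sum of index sets is used
  later.\<close>

lemma homogeneous_system:
  fixes M :: "nat \<Rightarrow> 'j \<Rightarrow> 'k::field"
  assumes "finite J" "m < card J"
  shows "\<exists>c. (\<exists>j\<in>J. c j \<noteq> 0) \<and> (\<forall>i<m. (\<Sum>j\<in>J. c j * M i j) = 0)"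
  using assms
proof (induction m arbitrary: J M)
  case 0
  then have "\<exists>j. j \<in> J" by (auto simp: card_gt_0_iff)
  then show ?case by (intro exI[of _ "\<lambda>_. 1"]) auto
next
  case (Suc m)
  show ?case
  proof (cases "\<exists>p\<in>J. M m p \<noteq> 0")
    case False
    from Suc.IH[OF Suc.prems(1), of M] Suc.prems(2)
    obtain c where "\<exists>j\<in>J. c j \<noteq> 0" "\<forall>i<m. (\<Sum>j\<in>J. c j * M i j) = 0" by auto
    with False show ?thesis by (intro exI[of _ c]) (auto simp: less_Suc_eq)
  next
    case True
    then obtain p where p: "p \<in> J" "M m p \<noteq> 0" by blast
    define J' where "J' = J - {p}"
    have J': "finite J'" "m < card J'" "p \<notin> J'" "J = insert p J'"
      using Suc.prems p by (auto simp: J'_def card_Diff_singleton)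
    from Suc.IH[OF J'(1,2), of "\<lambda>i j. M i j - M m j / M m p * M i p"]
    obtain c where c: "\<exists>j\<in>J'. c j \<noteq> 0"
      "\<And>i. i < m \<Longrightarrow> (\<Sum>j\<in>J'. c j * (M i j - M m j / M m p * M i p)) = 0" by auto
    \<comment> \<open>The eliminated unknown is recovered by solving equation \<open>m\<close> for
      it.\<close>
    define c' where "c' = c(p := - (\<Sum>j\<in>J'. c j * M m j) / M m p)"
    have sum: "(\<Sum>j\<in>J. c' j * M i j) = (\<Sum>j\<in>J'. c j * (M i j - M m j / M m p * M i p))" for i
    proof -
      have "(\<Sum>j\<in>J. c' j * M i j) = c' p * M i p + (\<Sum>j\<in>J'. c' j * M i j)"
        using J' by simp
      also have "(\<Sum>j\<in>J'. c' j * M i j) = (\<Sum>j\<in>J'. c j * M i j)"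
        using J'(3) by (intro sum.cong) (auto simp: c'_def)
      also have "c' p * M i p = (\<Sum>j\<in>J'. - (c j * (M m j / M m p * M i p)))"
        by (simp add: c'_def sum_negf sum_divide_distrib sum_distrib_right mult.assoc)
      finally show ?thesis by (simp add: right_diff_distrib sum_subtractf sum_negf)
    qed
    have "(\<Sum>j\<in>J. c' j * M m j) = 0" unfolding sum using p(2) by simp
    moreover have "\<exists>j\<in>J. c' j \<noteq> 0" using c(1) J'(3,4) by (auto simp: c'_def)
    ultimately show ?thesis using c(2) sum
      by (intro exI[of _ c']) (auto simp: less_Suc_eq)
  qed
qed

section \<open>Orthogonality to finite-dimensional subspaces\<close>

context hilbert_space
begin

lemma norm_le_norm_diff_orthogonal:
  assumes "ip f z = 0"
  shows "norm f \<le> norm (f - z)"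
proof (rule power2_le_imp_le)
  have "ip f (- z) = 0" using assms ip_diff_right[of f 0 z] by simp
  from pythagoras[OF this] show "(norm f)\<^sup>2 \<le> (norm (f - z))\<^sup>2" by simp
qed simp

lemma ip_span_eq_0:
  assumes "\<And>b. b \<in> B \<Longrightarrow> ip f b = 0" "z \<in> span B"
  shows "ip f z = 0"
  using assms(2)
  by (induction rule: span_induct_alt) (auto simp: ip_add_right ip_scale_right assms(1))

text \<open>Orthogonality to \<open>span B\<close> amounts to \<open>card B\<close> homogeneous
  equations in the coefficients. This is the dimension count behind the lower bound for widths and
  behind the estimate for covering operators.\<close>

lemma exists_combination_orthogonal:
  assumes "finite B" "finite J" "card B < card J"
  shows "\<exists>c. (\<exists>j\<in>J. c j \<noteq> 0) \<and> (\<forall>z\<in>span B. ip (\<Sum>j\<in>J. scale (c j) (v j)) z = 0)"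
proof -
  obtain b where b: "B = b ` {..<card B}"
    using ex_bij_betw_nat_finite[OF assms(1)] by (metis bij_betw_imp_surj_on atLeast0LessThan)
  obtain c where c: "\<exists>j\<in>J. c j \<noteq> 0"
    "\<And>i. i < card B \<Longrightarrow> (\<Sum>j\<in>J. c j * ip (v j) (b i)) = 0"
    using homogeneous_system[OF assms(2,3), of "\<lambda>i j. ip (v j) (b i)"] by blast
  have "ip (\<Sum>j\<in>J. scale (c j) (v j)) z = 0" if "z \<in> B" for z
    using that c(2) by (subst (asm) b) (auto simp: ip_sum_left ip_scale_left)
  then show ?thesis using c(1) ip_span_eq_0 by blast
qed

lemma orthonormal_independent:
  assumes "orthonormal I u"
  shows "inj_on u I" "\<not> dependent (u ` I)"
proof -
  show inj: "inj_on u I"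
  proof (rule inj_onI)
    fix i j assume ij: "i \<in> I" "j \<in> I" "u i = u j"
    then have "ip (u i) (u j) = 1" using orthonormalD[OF assms, of j j] by simp
    then show "i = j" using orthonormalD[OF assms ij(1,2)] by (auto split: if_splits)
  qed
  show "\<not> dependent (u ` I)"
    unfolding dependent_explicit
  proof safe
    fix S c v assume S: "finite S" "S \<subseteq> u ` I" "(\<Sum>v\<in>S. scale (c v) v) = 0" and v: "v \<in> S" "c v \<noteq> 0"
    have "0 = ip (\<Sum>v\<in>S. scale (c v) v) v" by (simp add: S)
    also have "\<dots> = (\<Sum>w\<in>S. c w * ip w v)" by (simp add: ip_sum_left ip_scale_left)
    also have "\<dots> = (\<Sum>w\<in>S. if w = v then c w else 0)"
    proof (rule sum.cong)
      fix w assume "w \<in> S"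
      then obtain i j where "i \<in> I" "j \<in> I" "w = u i" "v = u j" using S(2) v(1) by blast
      then show "c w * ip w v = (if w = v then c w else 0)"
        using inj orthonormalD[OF assms] by (auto simp: inj_on_def)
    qed simp
    also have "\<dots> = c v" using S v by simp
    finally show False using v by simp
  qed
qed

end

section \<open>Singular value decomposition of compact operators\<close>

context hilbert_pair
begin

text \<open>The last clause records the extremal property of singular values; together with
  \<open>s\<close> tending to 0 it yields the series expansion of \<open>A\<close>. Counting from 0
  makes \<open>s n\<close> the width of order \<open>n\<close>.\<close>

definition singular_system :: "('a \<Rightarrow> 'b) \<Rightarrow> (nat \<Rightarrow> 'a) \<Rightarrow> (nat \<Rightarrow> 'b) \<Rightarrow> (nat \<Rightarrow> real) \<Rightarrow> bool" where
  "singular_system A e u s \<longleftrightarrow>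
     A \<in> bounded_operators s1 s2 \<and> H1.orthonormal UNIV e \<and> H2.orthonormal UNIV u \<and>
     (\<forall>n. 0 < s n) \<and> decseq s \<and> s \<longlonglongrightarrow> 0 \<and>
     (\<forall>n. A (e n) = s2 (of_real (s n)) (u n)) \<and>
     (\<forall>n x. (\<forall>i<n. ip1 x (e i) = 0) \<longrightarrow> norm (A x) \<le> s n * norm x)"

text \<open>If \<open>A\<close> vanished on the orthogonal complement of
  \<open>f 0, ..., f (n - 1)\<close>, the images of these vectors would span its range. Hence the
  successive choice of singular vectors never stops.\<close>

lemma infinite_rank_complement:
  assumes A: "A \<in> bounded_operators s1 s2" and inf: "infinite_dimensional s2 (range A)"
    and f: "H1.orthonormal {..<n} f"
  obtains z where "\<forall>i<n. ip1 z (f i) = 0" "A z \<noteq> 0"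
proof (rule ccontr)
  assume "\<not> thesis"
  with that have 0: "A z = 0" if "\<forall>i<n. ip1 z (f i) = 0" for z using that by blast
  have "A x \<in> H2.span (A ` f ` {..<n})" for x
  proof -
    have "A (x - H1.proj {..<n} f x) = 0"
      using H1.proj_residual_orth[OF f] by (intro 0) auto
    then have "A x = (\<Sum>i<n. s2 (ip1 x (f i)) (A (f i)))"
      by (simp add: bo_diff[OF A] H1.proj_def bo_sum[OF A] bo_scale[OF A])
    also have "\<dots> \<in> H2.span (A ` f ` {..<n})"
      by (intro H2.span_sum H2.span_scale H2.span_base) auto
    finally show ?thesis .
  qed
  then have "finite (A ` f ` {..<n}) \<and> range A \<subseteq> H2.span (A ` f ` {..<n})" by auto
  with inf show False unfolding infinite_dimensional_def by blast
qed

text \<open>Greedy construction: \<open>e n\<close> maximizes \<open>norm (A x)\<close> among the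
  unit vectors orthogonal to all earlier choices. Maximality makes the images \<open>A (e n)\<close>
  mutually orthogonal, and \<open>u n\<close> is the normalized image.\<close>

theorem singular_system_exists:
  assumes cpt: "compact_operator s1 s2 A" and inf: "infinite_dimensional s2 (range A)"
  obtains e u s where "singular_system A e u s"
proof -
  have A: "A \<in> bounded_operators s1 s2" and K: "compact (closure (A ` cball 0 1))"
    using cpt by (auto simp: compact_operator_def)
  define S where "S f n = {z. \<forall>i<n. ip1 z (f i) = 0}" for f :: "nat \<Rightarrow> 'a" and n
  define P where "P f n x \<longleftrightarrow> norm x = 1 \<and> x \<in> S f n \<and> (\<forall>z\<in>S f n. norm (A z) \<le> norm (A x) * norm z)"
    for f :: "nat \<Rightarrow> 'a" and n x
  have orth: "H1.orthonormal I f" if "\<And>i. i \<in> I \<Longrightarrow> P f i (f i)" for f :: "nat \<Rightarrow> 'a" and I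
    unfolding H1.orthonormal_def
  proof safe
    fix i j assume ij: "i \<in> I" "j \<in> I"
    consider "i < j" | "j < i" | "i = j" by linarith
    then show "ip1 (f i) (f j) = of_bool (i = j)"
    proof cases
      case 1
      with that[OF ij(2)] have "ip1 (f j) (f i) = 0" by (auto simp: P_def S_def)
      with 1 show ?thesis by (simp add: H1.ip_eq_0_commute[of "f i"])
    next
      case 2
      with that[OF ij(1)] show ?thesis by (auto simp: P_def S_def)
    next
      case 3
      with that[OF ij(1)] show ?thesis using H1.ip_self[of "f i"] by (simp add: P_def)
    qed
  qed
  \<comment> \<open>The choice at stage \<open>n\<close> depends on all earlier values and on
    nothing else of \<open>f\<close>; the first goal verifies the latter.\<close>
  have "\<exists>f. \<forall>n. P f n (f n)"
  proof (rule dependent_wellorder_choice)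
    fix r f g and n :: nat
    assume "\<And>y. y < n \<Longrightarrow> (f y :: 'a) = g y"
    then have "S f n = S g n" by (simp add: S_def)
    then show "P f n r = P g n r" by (simp add: P_def)
  next
    fix n :: nat and f
    assume "\<And>y. y < n \<Longrightarrow> P f y (f y)"
    then have "H1.orthonormal {..<n} f" by (intro orth) auto
    from infinite_rank_complement[OF A inf this]
    obtain z0 where z0: "z0 \<in> S f n" "A z0 \<noteq> 0" by (auto simp: S_def)
    have cl: "closed (S f n)"
    proof -
      have "S f n = (\<Inter>i\<in>{..<n}. {z. ip1 z (f i) = 0})" by (auto simp: S_def)
      moreover have "closed {z. ip1 z (f i) = 0}" for i
        by (intro closed_Collect_eq linear_continuous_on H1.bounded_linear_ip_left continuous_on_const)
      ultimately show ?thesis by (auto intro!: closed_INT)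
    qed
    have scl: "s1 c x \<in> S f n" if "x \<in> S f n" for c x
      using that by (simp add: S_def H1.ip_scale_left)
    have add: "x + y \<in> S f n" if "x \<in> S f n" "y \<in> S f n" for x y
      using that by (simp add: S_def H1.ip_add_left)
    show "\<exists>x. P f n x"
    proof (rule norm_attained[OF A K scl add cl z0])
      fix x assume "x \<in> S f n" "norm x = 1" "\<And>z. z \<in> S f n \<Longrightarrow> norm (A z) \<le> norm (A x) * norm z"
      then have "P f n x" by (simp add: P_def)
      then show ?thesis ..
    qed
  qed
  then obtain e :: "nat \<Rightarrow> 'a" where e: "\<And>n. P e n (e n)" by blast
  have oe: "H1.orthonormal UNIV e" by (intro orth e)
  define s where "s n = norm (A (e n))" for n
  define u where "u n = s2 (of_real (1 / s n)) (A (e n))" for n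
  have bound: "norm (A x) \<le> s n * norm x" if "x \<in> S e n" for x n
    using e[of n] that by (auto simp: P_def s_def)
  have pos: "s n > 0" for n
  proof -
    from infinite_rank_complement[OF A inf H1.orthonormal_mono[OF oe subset_UNIV]]
    obtain z where "z \<in> S e n" "A z \<noteq> 0" by (auto simp: S_def)
    with bound[of z n] show ?thesis by (auto simp: s_def)
  qed
  have Ae: "A (e n) = s2 (of_real (s n)) (u n)" for n
    using pos[of n] by (simp add: u_def)
  have orthA: "ip2 (A (e i)) (A (e j)) = 0" if "i \<noteq> j" for i j
  proof -
    have "ip2 (A (e i)) (A (e j)) = 0" if "i < j" for i j
    proof (rule maximizer_orthogonal[OF A])
      show "norm (e i) = 1" using e[of i] by (simp add: P_def)
      show "ip1 (e i) (e j) = 0" using H1.orthonormalD[OF oe] that by simp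
      have "e i + s1 c (e j) \<in> S e i" for c
        using H1.orthonormalD[OF oe] that by (auto simp: S_def H1.ip_add_left H1.ip_scale_left)
      from bound[OF this] show "norm (A (e i + s1 c (e j))) \<le> norm (A (e i)) * norm (e i + s1 c (e j))" for c
        by (simp add: s_def)
    qed
    from this[of i j] this[of j i] that show ?thesis
      using H2.ip_eq_0_commute by (meson linorder_neqE_nat)
  qed
  have ou: "H2.orthonormal UNIV u"
    unfolding H2.orthonormal_def
  proof safe
    fix i j
    show "ip2 (u i) (u j) = of_bool (i = j)"
    proof (cases "i = j")
      case True
      have "norm (u j) = 1" using pos[of j] by (simp add: u_def H2.norm_scale norm_divide s_def)
      with True show ?thesis using H2.ip_self[of "u j"] by simp
    qed (simp add: u_def H2.ip_scale_left H2.ip_scale_right orthA)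
  qed
  have dec: "decseq s"
  proof (rule decseq_SucI)
    fix n
    have "e (Suc n) \<in> S e n" using e[of "Suc n"] by (auto simp: P_def S_def)
    from bound[OF this] show "s (Suc n) \<le> s n" using e[of "Suc n"] by (simp add: P_def s_def)
  qed
  have "s \<longlonglongrightarrow> 0"
  proof -
    have "\<forall>i. 0 \<le> s i" using pos by (auto intro: less_imp_le)
    from decseq_convergent[OF dec this]
    obtain L where L: "s \<longlonglongrightarrow> L" "\<forall>i. L \<le> s i" .
    have "L \<ge> 0" by (rule LIMSEQ_le_const[OF L(1)]) (use pos in \<open>auto intro: less_imp_le\<close>)
    \<comment> \<open>Otherwise the mutually orthogonal images \<open>A (e n)\<close> would stay at
      distance at least \<open>L\<close> from each other, so none of their subsequences could be
      Cauchy, against compactness.\<close>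
    have "L = 0"
    proof (rule ccontr)
      assume "L \<noteq> 0"
      with \<open>L \<ge> 0\<close> have "L > 0" by simp
      have "\<forall>n. A (e n) \<in> closure (A ` cball 0 1)"
        using e by (intro allI subsetD[OF closure_subset] imageI) (simp add: P_def)
      from seq_compactE[OF K[unfolded compact_eq_seq_compact_metric] this]
      obtain y r where r: "strict_mono r" "(\<lambda>n. A (e (r n))) \<longlonglongrightarrow> y"
        unfolding o_def by metis
      from LIMSEQ_imp_Cauchy[OF r(2)] \<open>L > 0\<close>
      obtain N where N: "\<And>m n. m \<ge> N \<Longrightarrow> n \<ge> N \<Longrightarrow> dist (A (e (r m))) (A (e (r n))) < L"
        unfolding Cauchy_def by blast
      let ?i = "r N" and ?j = "r (Suc N)"
      have "?i \<noteq> ?j" using r(1) by (metis n_not_Suc_n strict_mono_eq)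
      from orthA[OF this] have "ip2 (A (e ?i)) (A (e ?j)) = 0" .
      from H2.norm_le_norm_diff_orthogonal[OF this] have "s ?i \<le> dist (A (e ?i)) (A (e ?j))"
        by (simp add: s_def dist_norm)
      with N[of N "Suc N"] spec[OF L(2), of ?i] show False by simp
    qed
    with L show ?thesis by simp
  qed
  with A oe ou pos dec Ae bound have "singular_system A e u s"
    by (auto simp: singular_system_def S_def)
  then show thesis by (rule that)
qed

context
  fixes A e u s
  assumes ss: "singular_system A e u s"
begin

lemma
  shows ss_bo: "A \<in> bounded_operators s1 s2" and ss_e: "H1.orthonormal I e"
    and ss_u: "H2.orthonormal I u" and ss_pos: "0 < s n" and ss_decseq: "decseq s"
    and ss_tendsto: "s \<longlonglongrightarrow> 0" and ss_eq: "A (e n) = s2 (of_real (s n)) (u n)"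
    and ss_bound: "(\<And>i. i < n \<Longrightarrow> ip1 x (e i) = 0) \<Longrightarrow> norm (A x) \<le> s n * norm x"
  using ss H1.orthonormal_mono[of UNIV e I] H2.orthonormal_mono[of UNIV u I]
  by (auto simp: singular_system_def)

text \<open>The truncation equals \<open>A\<close> at the projection of \<open>x\<close> onto the
  first \<open>n\<close> vectors of \<open>e\<close>, so the error is \<open>A\<close> at a vector
  orthogonal to all of them.\<close>

lemma singular_truncation_error:
  "norm (A x - (\<Sum>i<n. s2 (of_real (s i) * ip1 x (e i)) (u i))) \<le> s n * norm x"
proof -
  have "A x - (\<Sum>i<n. s2 (of_real (s i) * ip1 x (e i)) (u i)) = A (x - H1.proj {..<n} e x)"
    by (simp add: bo_diff[OF ss_bo] H1.proj_def bo_sum[OF ss_bo] bo_scale[OF ss_bo] ss_eq mult.commute)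
  also have "norm \<dots> \<le> s n * norm (x - H1.proj {..<n} e x)"
    by (intro ss_bound H1.proj_residual_orth[OF ss_e]) auto
  also have "\<dots> \<le> s n * norm x"
    using ss_pos[of n] by (intro mult_left_mono H1.norm_proj_residual_le[OF ss_e]) auto
  finally show ?thesis .
qed

lemma singular_expansion: "(\<lambda>n. s2 (of_real (s n) * ip1 x (e n)) (u n)) sums A x"
proof -
  have "(\<lambda>n. A x - (\<Sum>i<n. s2 (of_real (s i) * ip1 x (e i)) (u i))) \<longlonglongrightarrow> 0"
    by (rule Lim_null_comparison[OF _ tendsto_mult_left_zero[OF ss_tendsto, of "norm x"]])
      (simp add: singular_truncation_error)
  from tendsto_diff[OF tendsto_const[of "A x"] this] show ?thesis by (simp add: sums_def)
qed

text \<open>On the span of \<open>u 0, ..., u n\<close> the operator is inverted diagonally,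
  dividing by numbers \<open>s j\<close> that are at least \<open>s n\<close>.\<close>

lemma singular_preimage:
  obtains g where "A g = (\<Sum>j\<le>n. s2 (d j) (u j))"
    "s n * norm g \<le> norm (\<Sum>j\<le>n. s2 (d j) (u j))"
proof
  define g where "g = (\<Sum>j\<le>n. s1 (d j / of_real (s j)) (e j))"
  have s: "0 < s j" "s j \<noteq> 0" for j using ss_pos[of j] by auto
  show "A g = (\<Sum>j\<le>n. s2 (d j) (u j))"
    unfolding g_def bo_sum[OF ss_bo] bo_scale[OF ss_bo] ss_eq using s(2) by simp
  show "s n * norm g \<le> norm (\<Sum>j\<le>n. s2 (d j) (u j))"
  proof (rule power2_le_imp_le)
    have "(s n * norm g)\<^sup>2 = (\<Sum>j\<le>n. (s n)\<^sup>2 * (norm (d j / of_real (s j)))\<^sup>2)"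
      unfolding g_def by (simp add: power_mult_distrib H1.norm_sum_orthonormal[OF ss_e] sum_distrib_left)
    also have "\<dots> \<le> (\<Sum>j\<le>n. (norm (d j))\<^sup>2)"
    proof (rule sum_mono)
      fix j assume "j \<in> {..n}"
      then have "s n \<le> s j" using ss_decseq by (auto simp: decseq_def)
      then have "s n * norm (d j) / s j \<le> norm (d j)"
        using s(1)[of j] by (simp add: pos_divide_le_eq mult.commute[of "norm (d j)"] mult_right_mono)
      then have "(s n * norm (d j) / s j)\<^sup>2 \<le> (norm (d j))\<^sup>2"
        using s(1)[of j] s(1)[of n] by (intro power_mono) auto
      then show "(s n)\<^sup>2 * (norm (d j / of_real (s j)))\<^sup>2 \<le> (norm (d j))\<^sup>2"
        using s(1)[of j] by (simp add: norm_divide power_mult_distrib power_divide)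
    qed
    also have "\<dots> = (norm (\<Sum>j\<le>n. s2 (d j) (u j)))\<^sup>2"
      by (simp add: H2.norm_sum_orthonormal[OF ss_u])
    finally show "(s n * norm g)\<^sup>2 \<le> (norm (\<Sum>j\<le>n. s2 (d j) (u j)))\<^sup>2" .
  qed simp
qed

text \<open>The span of the first \<open>n\<close> vectors of \<open>u\<close> attains the upper
  bound by the truncation error. For the lower bound, the span of \<open>u 0, ..., u n\<close>
  contains a nonzero vector orthogonal to any given subspace of dimension \<open>n\<close>, and a
  multiple of it with norm \<open>s n\<close> lies in the ellipsoid.\<close>

lemma kolmogorov_width_singular: "kolmogorov_width s2 (A ` cball 0 1) n = s n"
proof -
  let ?D = "\<lambda>X x. INF z\<in>X. norm (x - z)"
  let ?W = "\<lambda>X. SUP x\<in>A ` cball 0 1. ?D X x"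
  obtain K where K: "K > 0" "\<And>x. norm (A x) \<le> K * norm x" using bo_bound[OF ss_bo] by blast
  have sub: "0 \<in> X" if "X \<in> subspaces_of_dim s2 m" for X m
    using that by (auto simp: subspaces_of_dim_def intro: H2.span_zero)
  have D0: "0 \<le> ?D X x" if "0 \<in> X" for X x
    using that by (intro cINF_greatest) auto
  have D_le: "?D X x \<le> norm (x - z)" if "z \<in> X" for X x z
    using that by (intro cINF_lower bdd_belowI2[of _ 0]) auto
  have bdd: "bdd_above (?D X ` A ` cball 0 1)" if "0 \<in> X" for X
  proof (rule bdd_aboveI2)
    fix x assume "x \<in> A ` cball 0 1"
    then obtain g where "norm g \<le> 1" "x = A g" by auto
    have "?D X x \<le> norm x" using D_le[OF that, of x] by simp
    also have "\<dots> \<le> K * norm g" using K(2) \<open>x = A g\<close> by simp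
    also have "\<dots> \<le> K * 1" using K(1) \<open>norm g \<le> 1\<close> by (intro mult_left_mono) auto
    finally show "?D X x \<le> K" by simp
  qed
  have W_ge: "?D X (A g) \<le> ?W X" if "0 \<in> X" "norm g \<le> 1" for X g
    using that by (intro cSUP_upper bdd) auto
  show ?thesis
  proof (rule antisym)
    define X where "X = H2.span (u ` {..<n})"
    have X: "X \<in> subspaces_of_dim s2 n"
      using H2.orthonormal_independent[OF ss_u[of "{..<n}"]]
      by (auto simp: subspaces_of_dim_def X_def card_image intro!: exI[of _ "u ` {..<n}"])
    have "kolmogorov_width s2 (A ` cball 0 1) n \<le> ?W X"
      unfolding kolmogorov_width_def
    proof (intro cINF_lower X bdd_belowI2[of _ 0])
      fix X' assume "X' \<in> subspaces_of_dim s2 n"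
      with sub have "0 \<in> X'" by blast
      with W_ge[of X' 0] D0[of X' "A 0"] show "0 \<le> ?W X'" by simp
    qed
    also have "\<dots> \<le> s n"
    proof (rule cSUP_least)
      fix x assume "x \<in> A ` cball 0 1"
      then obtain g where g: "norm g \<le> 1" "x = A g" by auto
      have "(\<Sum>i<n. s2 (of_real (s i) * ip1 g (e i)) (u i)) \<in> X"
        unfolding X_def by (intro H2.span_sum H2.span_scale H2.span_base) auto
      from D_le[OF this, of x] singular_truncation_error[of g n] g(2)
      have "?D X x \<le> s n * norm g" by (simp add: order_trans)
      also have "\<dots> \<le> s n * 1" using ss_pos[of n] g(1) by (intro mult_left_mono) auto
      finally show "?D X x \<le> s n" by simp
    qed auto
    finally show "kolmogorov_width s2 (A ` cball 0 1) n \<le> s n" .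
  next
    have ne: "subspaces_of_dim s2 n \<noteq> {}"
      using H2.orthonormal_independent[OF ss_u[of "{..<n}"]]
      by (auto simp: subspaces_of_dim_def card_image intro!: exI[of _ "u ` {..<n}"])
    show "s n \<le> kolmogorov_width s2 (A ` cball 0 1) n"
      unfolding kolmogorov_width_def
    proof (rule cINF_greatest[OF ne])
      fix X assume X: "X \<in> subspaces_of_dim s2 n"
      then obtain B where B: "finite B" "card B = n" "X = H2.span B"
        by (auto simp: subspaces_of_dim_def)
      from H2.exists_combination_orthogonal[of B "{..n}" u] B obtain c where
        c: "\<exists>j\<le>n. c j \<noteq> 0" "\<And>z. z \<in> X \<Longrightarrow> ip2 (\<Sum>j\<le>n. s2 (c j) (u j)) z = 0"
        by auto
      let ?f = "\<Sum>j\<le>n. s2 (c j) (u j)"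
      have "(norm ?f)\<^sup>2 = (\<Sum>j\<le>n. (norm (c j))\<^sup>2)"
        by (rule H2.norm_sum_orthonormal[OF ss_u]) simp
      also have "\<dots> > 0"
      proof -
        from c(1) obtain j where "j \<le> n" "c j \<noteq> 0" by blast
        then show ?thesis by (intro sum_pos2[of _ j]) auto
      qed
      finally have f0: "norm ?f > 0" by simp
      obtain g0 where g0: "A g0 = ?f" "s n * norm g0 \<le> norm ?f" using singular_preimage .
      \<comment> \<open>This scaling gives \<open>f\<close> norm exactly \<open>s n\<close>, while
        the estimate for \<open>g0\<close> keeps the preimage \<open>g\<close> in the unit
        ball.\<close>
      define r :: 'k where "r = of_real (s n / norm ?f)"
      have r: "norm r = s n / norm ?f" using ss_pos[of n] by (simp add: r_def norm_divide)
      define g where "g = s1 r g0"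
      define f where "f = s2 r ?f"
      have Ag: "A g = f" by (simp add: g_def f_def bo_scale[OF ss_bo] g0)
      have g1: "norm g \<le> 1" using g0(2) f0 by (simp add: g_def H1.norm_scale r)
      have "norm f = s n" using f0 by (simp add: f_def H2.norm_scale r)
      have "X \<noteq> {}" using sub[OF X] by auto
      then have "s n \<le> ?D X f"
      proof (rule cINF_greatest)
        fix z assume "z \<in> X"
        then have "ip2 f z = 0" by (simp add: f_def H2.ip_scale_left c(2))
        from H2.norm_le_norm_diff_orthogonal[OF this] \<open>norm f = s n\<close>
        show "s n \<le> norm (f - z)" by simp
      qed
      also have "\<dots> \<le> ?W X" using W_ge[OF sub[OF X] g1] Ag by simp
      finally show "s n \<le> ?W X" .
    qed
  qed
qed

end

end

subsection \<open>Operators whose image covers an operator range\<close>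

lemma bounded_operators_compose:
  assumes "T \<in> bounded_operators s2 s3" "A \<in> bounded_operators s1 s2"
  shows "(\<lambda>x. T (A x)) \<in> bounded_operators s1 s3"
  using assms bounded_linear_compose[of T A]
  by (simp add: bounded_operators_def Vector_Spaces.linear_iff)

context hilbert_pair
begin

text \<open>The open mapping argument, with the closure of the image of a ball instead of the image
  itself; this suffices for estimating widths and avoids weak compactness of the ball.\<close>

lemma range_subset_approximation:
  assumes A: "A \<in> bounded_operators s1 s2" and B: "B \<in> bounded_operators s1 s2"
    and sub: "range A \<subseteq> range B"
  obtains C where "C > 0" "\<And>h \<epsilon>. \<epsilon> > 0 \<Longrightarrow> \<exists>g. norm g \<le> C * norm h \<and> norm (A h - B g) < \<epsilon>"
proof -
  \<comment> \<open>Baire's theorem is applied in the domain: these closed sets cover it because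
    every \<open>A x\<close> has some preimage under \<open>B\<close>.\<close>
  define F where "F n = A -` closure (B ` cball 0 (real n))" for n :: nat
  have cont: "continuous_on UNIV A"
    using linear_continuous_on[OF bo_bounded_linear[OF A]] .
  have cl: "closed (F n)" for n
    unfolding F_def by (intro closed_vimage closed_closure cont)
  have "\<Union>(range F) = UNIV"
  proof safe
    fix x
    obtain g where g: "A x = B g" using sub by blast
    obtain n where "norm g \<le> real n" using real_arch_simple by blast
    then have "A x \<in> B ` cball 0 (real n)" using g by auto
    then have "x \<in> F n" using closure_subset unfolding F_def by blast
    then show "x \<in> \<Union>(range F)" by blast
  qed simp
  moreover have "interior (\<Union>(range F)) = {}" if "\<And>n. interior (F n) = {}"
    using Baire_category_alt[of "euclidean :: 'a topology" "range F"] cl that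
    by (auto simp: completely_metrizable_space_euclidean)
  ultimately obtain n where "interior (F n) \<noteq> {}" by force
  then obtain x0 r where r: "r > 0" "ball x0 r \<subseteq> F n"
    by (auto simp: mem_interior)
  have small: "\<exists>g. norm g \<le> real n \<and> norm (A h - B g) < \<epsilon>" if h: "norm h < r" and \<epsilon>: "\<epsilon> > 0" for h \<epsilon>
  proof -
    have "\<exists>g. norm g \<le> real n \<and> norm (A z - B g) < \<epsilon>" if "dist x0 z < r" for z
    proof -
      have "A z \<in> closure (B ` cball 0 (real n))" using r(2) that by (auto simp: F_def)
      then obtain y where "y \<in> B ` cball 0 (real n)" "dist y (A z) < \<epsilon>"
        using \<epsilon> unfolding closure_approachable by blast
      then show ?thesis by (auto simp: dist_norm norm_minus_commute)
    qed
    \<comment> \<open>Half the difference of approximate preimages for \<open>x0 + h\<close> and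
      \<open>x0 - h\<close> removes the centre \<open>x0\<close> without enlarging the bound
      \<open>n\<close> or the error.\<close>
    from this[of "x0 + h"] this[of "x0 - h"] h obtain g1 g2
      where g: "norm g1 \<le> real n" "norm (A (x0 + h) - B g1) < \<epsilon>"
        "norm g2 \<le> real n" "norm (A (x0 - h) - B g2) < \<epsilon>" by (auto simp: dist_norm)
    interpret A: bounded_linear A using bo_bounded_linear[OF A] .
    interpret B: bounded_linear B using bo_bounded_linear[OF B] .
    have "A h - B ((1/2) *\<^sub>R (g1 - g2)) = (1/2) *\<^sub>R ((A (x0 + h) - B g1) - (A (x0 - h) - B g2))"
      by (simp add: A.scaleR B.scaleR A.add A.diff B.diff algebra_simps flip: scaleR_add_left)
    then have "norm (A h - B ((1/2) *\<^sub>R (g1 - g2))) < \<epsilon>"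
      using norm_triangle_ineq4[of "A (x0 + h) - B g1" "A (x0 - h) - B g2"] g(2,4) by simp
    moreover have "norm ((1/2) *\<^sub>R (g1 - g2)) \<le> real n"
      using norm_triangle_ineq4[of g1 g2] g(1,3) by simp
    ultimately show ?thesis by blast
  qed
  \<comment> \<open>The quotient comes from rescaling \<open>h\<close> to norm \<open>r / 2\<close>;
    the summand 1 keeps \<open>C\<close> positive when \<open>n\<close> is 0.\<close>
  define C where "C = 2 * real n / r + 1"
  have "\<exists>g. norm g \<le> C * norm h \<and> norm (A h - B g) < \<epsilon>" if \<epsilon>: "\<epsilon> > 0" for h \<epsilon>
  proof (cases "h = 0")
    case True
    then show ?thesis using \<epsilon> by (intro exI[of _ 0]) (simp add: bo_zero[OF A] bo_zero[OF B])
  next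
    case False
    define q where "q = r / (2 * norm h)"
    have q: "q > 0" using False r(1) by (simp add: q_def)
    have "norm (q *\<^sub>R h) < r" using False r(1) by (simp add: q_def)
    from small[OF this, of "q * \<epsilon>"] q \<epsilon> obtain g
      where g: "norm g \<le> real n" "norm (A (q *\<^sub>R h) - B g) < q * \<epsilon>" by auto
    interpret A: bounded_linear A using bo_bounded_linear[OF A] .
    interpret B: bounded_linear B using bo_bounded_linear[OF B] .
    have "A h - B ((1 / q) *\<^sub>R g) = (1 / q) *\<^sub>R (A (q *\<^sub>R h) - B g)"
      using q by (simp add: A.scaleR B.scaleR scaleR_diff_right)
    then have "norm (A h - B ((1 / q) *\<^sub>R g)) = norm (A (q *\<^sub>R h) - B g) / q"
      using q by simp
    then have "norm (A h - B ((1 / q) *\<^sub>R g)) < \<epsilon>"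
      using g(2) q by (simp add: pos_divide_less_eq mult.commute)
    moreover have "norm ((1 / q) *\<^sub>R g) \<le> C * norm h"
    proof -
      have "norm ((1 / q) *\<^sub>R g) \<le> (1 / q) * real n"
        using g(1) q by (simp add: divide_right_mono)
      also have "\<dots> = 2 * real n / r * norm h" by (simp add: q_def)
      also have "\<dots> \<le> C * norm h" by (simp add: C_def distrib_right)
      finally show ?thesis .
    qed
    ultimately show ?thesis by blast
  qed
  moreover have "C > 0" using r(1) by (simp add: C_def add_nonneg_pos)
  ultimately show thesis using that by blast
qed

end

section \<open>Singular value estimate forced by a covering operator\<close>

locale hilbert_triple = H0: hilbert_space s0 ip0 + H1: hilbert_space s1 ip1 + H2: hilbert_space s2 ip2
  for s0 :: "'k::rc_field \<Rightarrow> 'h::{real_inner, banach} \<Rightarrow> 'h" and ip0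
    and s1 :: "'k \<Rightarrow> 'a::{real_inner, banach} \<Rightarrow> 'a" and ip1
    and s2 :: "'k \<Rightarrow> 'b::{real_inner, banach} \<Rightarrow> 'b" and ip2
begin

sublocale P01: hilbert_pair s0 ip0 s1 ip1 ..
sublocale P02: hilbert_pair s0 ip0 s2 ip2 ..
sublocale P12: hilbert_pair s1 ip1 s2 ip2 ..

text \<open>Independence of the vectors \<open>R (x i)\<close> modulo the closure of the second
  range is expressed by unit vectors \<open>w j\<close> orthogonal to that range whose pairings with
  \<open>R (x i)\<close> are close to the identity matrix. This form survives small weak
  perturbations of \<open>R\<close>. The case \<open>m = 0\<close> compares nested ranges.\<close>

theorem covering_bound:
  assumes ss1: "P01.singular_system A1 e u s" and ss2: "P02.singular_system A2 f v t"
    and R: "R \<in> bounded_operators s1 s2" and cov: "range A2 \<subseteq> R ` range A1"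
    and x: "\<And>i. i < m \<Longrightarrow> x i \<in> range A1"
    and w: "\<And>i. i < m \<Longrightarrow> norm (w i) = 1" and vw: "\<And>n i. i < m \<Longrightarrow> ip2 (v n) (w i) = 0"
    and close: "\<And>i j. i < m \<Longrightarrow> j < m \<Longrightarrow>
      norm (of_bool (i = j) - ip2 (R (x i)) (w j)) \<le> 1 / (2 * real m)"
  obtains C where "C > 0" "\<And>n. t n \<le> C * s (n + m)"
proof -
  note A1 = P01.ss_bo[OF ss1] and A2 = P02.ss_bo[OF ss2]
  note s = P01.ss_pos[OF ss1] and t = P02.ss_pos[OF ss2]
  have RA1: "(\<lambda>h. R (A1 h)) \<in> bounded_operators s0 s2"
    by (rule bounded_operators_compose[OF R A1])
  have "range A2 \<subseteq> range (\<lambda>h. R (A1 h))" using cov by (simp add: image_image)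
  from P02.range_subset_approximation[OF A2 RA1 this] obtain C0 where C0: "C0 > 0"
    "\<And>h \<epsilon>. \<epsilon> > 0 \<Longrightarrow> \<exists>g. norm g \<le> C0 * norm h \<and> norm (A2 h - R (A1 g)) < \<epsilon>" by blast
  obtain K where K: "K > 0" "\<And>y. norm (R y) \<le> K * norm y" using P12.bo_bound[OF R] by blast
  have "\<forall>i. \<exists>g. i < m \<longrightarrow> x i = A1 g" using x by blast
  from choice[OF this] obtain g0 where g0: "\<And>i. i < m \<Longrightarrow> x i = A1 (g0 i)" by blast
  define X where "X = (\<Sum>i<m. norm (R (x i)))"
  define G where "G = (\<Sum>i<m. norm (g0 i))"
  have X: "norm (R (x i)) \<le> X" if "i < m" for i
    unfolding X_def using that by (intro member_le_sum) auto
  have G: "norm (g0 i) \<le> G" if "i < m" for i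
    unfolding G_def using that by (intro member_le_sum) auto
  have XG: "X \<ge> 0" "G \<ge> 0" by (auto simp: X_def G_def intro: sum_nonneg)
  \<comment> \<open>The constant is read off from the final chain of estimates: the first summand
    bounds the preimage of \<open>p\<close>, the second that of \<open>q\<close>.\<close>
  define C where "C = K * (C0 * (1 + 2 * real m * X) + 2 * real m * G * t 0)"
  have "C > 0" unfolding C_def using K(1) C0(1) XG less_imp_le[OF t[of 0]]
    by (intro mult_pos_pos add_pos_nonneg mult_nonneg_nonneg) auto
  moreover have "t n \<le> C * s (n + m)" for n
  proof -
    define B where "B = (\<lambda>j. R (u j)) ` {..<n + m}"
    \<comment> \<open>There are \<open>n + m + 1\<close> coefficients, \<open>m\<close> for the
      vectors \<open>R (x i)\<close> and \<open>n + 1\<close> for \<open>v 0, ..., v n\<close>,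
      against at most \<open>n + m\<close> orthogonality conditions.\<close>
    let ?J = "{..<m} <+> {..n}"
    have "card B \<le> n + m" unfolding B_def using card_image_le[of "{..<n+m}"] by fastforce
    then have "card B < card ?J" by (simp add: card_Plus)
    from H2.exists_combination_orthogonal[OF _ _ this, of "case_sum (\<lambda>i. R (x i)) v"]
    obtain c where c: "\<exists>j\<in>?J. c j \<noteq> 0"
      "\<And>z. z \<in> H2.span B \<Longrightarrow> ip2 (\<Sum>j\<in>?J. s2 (c j) (case_sum (\<lambda>i. R (x i)) v j)) z = 0"
      by (auto simp: B_def)
    define a where "a i = c (Inl i)" for i
    define b where "b i = c (Inr i)" for i
    define p where "p = (\<Sum>j\<le>n. s2 (b j) (v j))"
    define q where "q = (\<Sum>i<m. s2 (a i) (R (x i)))"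
    define \<phi> where "\<phi> = q + p"
    define \<alpha> where "\<alpha> = (\<Sum>i<m. norm (a i))"
    have ai: "norm (a i) \<le> \<alpha>" if "i < m" for i
      unfolding \<alpha>_def using that by (intro member_le_sum) auto
    have "(\<Sum>j\<in>?J. s2 (c j) (case_sum (\<lambda>i. R (x i)) v j)) = \<phi>"
      by (simp add: sum.Plus \<phi>_def p_def q_def a_def b_def)
    with c(2) have orth: "ip2 \<phi> z = 0" if "z \<in> H2.span B" for z using that by simp
    \<comment> \<open>Pairing \<open>\<phi>\<close> with \<open>w j\<close> removes \<open>p\<close>
      and recovers \<open>a j\<close> up to \<open>\<alpha> / (2 * real m)\<close>. Summed over
      \<open>j\<close> these errors amount to half of \<open>\<alpha>\<close> and are absorbed on
      the left.\<close>
    have \<alpha>: "\<alpha> \<le> 2 * real m * norm \<phi>"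
    proof -
      have "norm (a j) \<le> norm \<phi> + \<alpha> / (2 * real m)" if j: "j < m" for j
      proof -
        have "ip2 p (w j) = 0" by (simp add: p_def H2.ip_sum_left H2.ip_scale_left vw[OF j])
        then have eq1: "ip2 \<phi> (w j) = (\<Sum>i<m. a i * ip2 (R (x i)) (w j))"
          by (simp add: \<phi>_def q_def H2.ip_add_left H2.ip_sum_left H2.ip_scale_left)
        have eq2: "a j = (\<Sum>i<m. a i * of_bool (i = j))"
          using j by (simp add: of_bool_def if_distrib[of "\<lambda>y. _ * y"] cong: if_cong)
        from arg_cong2[OF eq2 eq1, of minus] have "a j - ip2 \<phi> (w j) = (\<Sum>i<m. a i * (of_bool (i = j) - ip2 (R (x i)) (w j)))"
          by (simp only: right_diff_distrib sum_subtractf)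
        also have "norm \<dots> \<le> (\<Sum>i<m. norm (a i) * (1 / (2 * real m)))"
          by (intro sum_norm_le) (simp only: norm_mult, intro mult_left_mono close[OF _ j], auto)
        also have "\<dots> = \<alpha> / (2 * real m)" by (simp add: \<alpha>_def sum_divide_distrib)
        finally have "norm (a j - ip2 \<phi> (w j)) \<le> \<alpha> / (2 * real m)" .
        moreover have "norm (ip2 \<phi> (w j)) \<le> norm \<phi>" using H2.norm_ip_le[of \<phi> "w j"] w[OF j] by simp
        ultimately show ?thesis using norm_triangle_ineq2[of "a j" "ip2 \<phi> (w j)"] by linarith
      qed
      then have "\<alpha> \<le> (\<Sum>j<m. norm \<phi> + \<alpha> / (2 * real m))" unfolding \<alpha>_def by (intro sum_mono) auto
      also have "\<dots> \<le> real m * norm \<phi> + \<alpha> / 2"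
        by (cases "m = 0") (auto simp: distrib_left \<alpha>_def)
      finally show ?thesis by simp
    qed
    have q: "norm q \<le> \<alpha> * X"
    proof -
      have "norm q \<le> (\<Sum>i<m. norm (a i) * X)"
        unfolding q_def by (intro sum_norm_le) (auto simp: H2.norm_scale intro!: mult_left_mono X)
      then show ?thesis by (simp add: \<alpha>_def sum_distrib_right)
    qed
    have p: "norm p \<le> (1 + 2 * real m * X) * norm \<phi>"
    proof -
      have "norm p \<le> norm \<phi> + norm q" using norm_triangle_ineq4[of \<phi> q] by (simp add: \<phi>_def)
      with q mult_right_mono[OF \<alpha> XG(1)] show ?thesis by (simp add: algebra_simps)
    qed
    have \<phi>0: "norm \<phi> > 0"
    proof (rule ccontr)
      assume "\<not> 0 < norm \<phi>"
      with \<alpha> p have 0: "\<alpha> \<le> 0" "norm p = 0" by auto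
      have "a i = 0" if "i < m" for i using order_trans[OF ai[OF that] 0(1)] by simp
      moreover have "(\<Sum>j\<le>n. (norm (b j))\<^sup>2) = 0"
        using H2.norm_sum_orthonormal[OF P02.ss_u[OF ss2], of "{..n}" b] 0(2) by (simp add: p_def)
      then have "b j = 0" if "j \<le> n" for j using that by (simp add: sum_nonneg_eq_0_iff)
      ultimately show False using c(1) by (auto simp: a_def b_def)
    qed
    obtain h where h: "A2 h = p" "t n * norm h \<le> norm p"
      using P02.singular_preimage[OF ss2, where n = n and d = b] unfolding p_def .
    \<comment> \<open>Truncating \<open>A1 g\<close> to its first \<open>n + m\<close> singular
      terms gives \<open>y\<close> with \<open>R y\<close> orthogonal to \<open>\<phi>\<close>; the
      truncation error supplies the factor \<open>s (n + m)\<close>.\<close>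
    have bound: "norm \<phi> \<le> norm (\<phi> - R (A1 g)) + K * (s (n + m) * norm g)" for g
    proof -
      define y where "y = (\<Sum>i<n+m. s1 (of_real (s i) * ip0 g (e i)) (u i))"
      have "R y = (\<Sum>i<n+m. s2 (of_real (s i) * ip0 g (e i)) (R (u i)))"
        by (simp add: y_def P12.bo_sum[OF R] P12.bo_scale[OF R])
      also have "\<dots> \<in> H2.span B"
        by (intro H2.span_sum H2.span_scale H2.span_base) (auto simp: B_def)
      finally have "norm \<phi> \<le> norm (\<phi> - R y)"
        by (intro H2.norm_le_norm_diff_orthogonal orth)
      also have "\<phi> - R y = (\<phi> - R (A1 g)) + R (A1 g - y)" by (simp add: P12.bo_diff[OF R])
      also have "norm \<dots> \<le> norm (\<phi> - R (A1 g)) + norm (R (A1 g - y))" by (rule norm_triangle_ineq)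
      also have "norm (R (A1 g - y)) \<le> K * norm (A1 g - y)" by (rule K(2))
      also have "\<dots> \<le> K * (s (n + m) * norm g)"
        using K(1) P01.singular_truncation_error[OF ss1, of g "n + m"]
        by (intro mult_left_mono) (auto simp: y_def)
      finally show ?thesis by simp
    qed
    have "norm \<phi> \<le> K * (s (n + m) * (C0 * norm h + \<alpha> * G))"
    proof (rule field_le_epsilon)
      fix \<epsilon> :: real assume "\<epsilon> > 0"
      from C0(2)[OF this, of h] obtain g' where g': "norm g' \<le> C0 * norm h" "norm (p - R (A1 g')) < \<epsilon>"
        by (auto simp: h)
      \<comment> \<open>The part \<open>q\<close> has an exact preimage, so only the error of the
        approximate preimage \<open>g'\<close> of \<open>p\<close> remains.\<close>
      define g where "g = g' + (\<Sum>i<m. s0 (a i) (g0 i))"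
      have "R (A1 g) = R (A1 g') + q"
        using g0 by (simp add: g_def q_def P01.bo_add[OF A1] P12.bo_add[OF R] P01.bo_sum[OF A1]
            P12.bo_sum[OF R] P01.bo_scale[OF A1] P12.bo_scale[OF R])
      then have "\<phi> - R (A1 g) = p - R (A1 g')" by (simp add: \<phi>_def)
      moreover have "norm g \<le> C0 * norm h + \<alpha> * G"
      proof -
        have "norm (\<Sum>i<m. s0 (a i) (g0 i)) \<le> (\<Sum>i<m. norm (a i) * G)"
          by (intro sum_norm_le) (auto simp: H0.norm_scale intro!: mult_left_mono G)
        then show ?thesis using g'(1) norm_triangle_ineq[of g' "\<Sum>i<m. s0 (a i) (g0 i)"]
          by (simp add: g_def \<alpha>_def sum_distrib_right)
      qed
      then have "K * (s (n + m) * norm g) \<le> K * (s (n + m) * (C0 * norm h + \<alpha> * G))"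
        using K(1) s[of "n + m"] by (intro mult_left_mono) auto
      ultimately show "norm \<phi> \<le> K * (s (n + m) * (C0 * norm h + \<alpha> * G)) + \<epsilon>"
        using bound[of g] g'(2) by simp
    qed
    \<comment> \<open>The norm of \<open>h\<close> is controlled only after multiplication by
      \<open>t n\<close>.\<close>
    then have "t n * norm \<phi> \<le> t n * (K * (s (n + m) * (C0 * norm h + \<alpha> * G)))"
      using t[of n] by (intro mult_left_mono) auto
    also have "\<dots> = K * s (n + m) * (C0 * (t n * norm h) + t n * (\<alpha> * G))" by (simp add: algebra_simps)
    also have "\<dots> \<le> K * s (n + m) * (C0 * ((1 + 2 * real m * X) * norm \<phi>) + t 0 * ((2 * real m * norm \<phi>) * G))"
    proof (intro mult_left_mono add_mono)
      show "t n * norm h \<le> (1 + 2 * real m * X) * norm \<phi>" using h(2) p by linarith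
      show "t n * (\<alpha> * G) \<le> t 0 * (2 * real m * norm \<phi> * G)"
        using P02.ss_decseq[OF ss2] t[of 0] XG \<alpha>
        by (intro mult_mono) (auto simp: decseq_def \<alpha>_def sum_nonneg intro: less_imp_le)
    qed (use K(1) C0(1) s[of "n + m"] in auto)
    also have "\<dots> = C * s (n + m) * norm \<phi>" by (simp add: C_def algebra_simps)
    finally show ?thesis using \<phi>0 by simp
  qed
  ultimately show thesis by (rule that)
qed

end

subsection \<open>Weak approximation by covering operators\<close>

lemma sum_lessThan_add:
  fixes f :: "nat \<Rightarrow> 'a::comm_monoid_add"
  shows "(\<Sum>i<N + M. f i) = (\<Sum>i<N. f i) + (\<Sum>i<M. f (i + N))"
  by (induction M) (simp_all add: add.assoc add.commute[of N])

context hilbert_space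
begin

lemma proj_self_adjoint: "ip (proj I e x) y = ip x (proj I e y)"
proof -
  have "scnj (ip y (e i)) = ip (e i) y" for i by (metis ip_commute)
  then show ?thesis
    by (simp add: proj_def ip_sum_left ip_sum_right ip_scale_left ip_scale_right mult.commute)
qed

lemma proj_orthonormal:
  assumes "orthonormal UNIV e" "finite I"
  shows "proj I e (e k) = (if k \<in> I then e k else 0)"
proof -
  have "proj I e (e k) = (\<Sum>i\<in>I. if i = k then e k else 0)"
    unfolding proj_def by (intro sum.cong) (auto simp: orthonormalD[OF assms(1)])
  then show ?thesis using assms(2) by simp
qed

end

section \<open>Swapping coordinate blocks of a partial isometry\<close>

context hilbert_pair
begin

lemma diagonal_apply:
  assumes "H1.orthonormal UNIV e" "\<And>x. (\<lambda>n. s2 (ip1 x (e n)) (f n)) sums D x"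
  shows "D (e k) = f k"
proof -
  have "(\<lambda>n. s2 (ip1 (e k) (e n)) (f n)) = (\<lambda>n. if n = k then f n else 0)"
    by (auto simp: H1.orthonormalD[OF assms(1)])
  with assms(2)[of "e k"] have "(\<lambda>n. if n = k then f n else 0) sums D (e k)" by simp
  then show ?thesis using sums_unique2 sums_single by blast
qed

text \<open>The squared norm is the sum of the squared coefficients with index from \<open>N\<close>
  to \<open>2 * N - 1\<close>, a difference of partial sums of a convergent series.\<close>

lemma shifted_coefficients_tendsto_0:
  assumes e: "H1.orthonormal UNIV e" and f: "H2.orthonormal UNIV f"
  shows "(\<lambda>N. \<Sum>i<N. s2 (ip1 x (e (i + N))) (f i)) \<longlonglongrightarrow> 0"
proof -
  define S where "S n = (\<Sum>i<n. (norm (ip1 x (e i)))\<^sup>2)" for n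
  have "S n \<le> (norm x)\<^sup>2" for n
    unfolding S_def using H1.bessel[OF H1.orthonormal_mono[OF e], of "{..<n}" x] by simp
  then have "summable (\<lambda>i. (norm (ip1 x (e i)))\<^sup>2)"
    unfolding S_def by (intro summableI_nonneg_bounded) auto
  then obtain L where L: "S \<longlonglongrightarrow> L" unfolding summable_def sums_def S_def by blast
  have "strict_mono (\<lambda>N::nat. N + N)" by (simp add: strict_mono_def)
  from LIMSEQ_subseq_LIMSEQ[OF L this] have "(\<lambda>N. S (N + N)) \<longlonglongrightarrow> L" by (simp add: o_def)
  from tendsto_diff[OF this L] have "(\<lambda>N. sqrt (S (N + N) - S N)) \<longlonglongrightarrow> 0"
    using tendsto_real_sqrt by fastforce
  moreover have "norm (\<Sum>i<N. s2 (ip1 x (e (i + N))) (f i)) = sqrt (S (N + N) - S N)" for N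
  proof -
    have "(norm (\<Sum>i<N. s2 (ip1 x (e (i + N))) (f i)))\<^sup>2 = S (N + N) - S N"
      using H2.norm_sum_orthonormal[OF H2.orthonormal_mono[OF f], of "{..<N}"]
      by (simp add: S_def sum_lessThan_add)
    from real_sqrt_unique[OF this norm_ge_zero] show ?thesis by (rule sym)
  qed
  ultimately show ?thesis by (subst tendsto_norm_zero_iff[symmetric]) (simp only:)
qed

text \<open>The identity blocks make the leading part invertible whatever the compression of
  \<open>T\<close> is, and they tend weakly to 0 because they move coordinates by \<open>N\<close>.
  \<open>P\<close> and \<open>P'\<close> are the orthogonal projections onto the closed spans of
  \<open>u\<close> and \<open>v\<close>; since \<open>P\<close> fixes \<open>Y\<close>, the term
  \<open>T (x - P x)\<close> leaves the image of \<open>Y\<close> unchanged.\<close>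

lemma partial_swap_approximation:
  assumes u: "H1.orthonormal UNIV u" and v: "H2.orthonormal UNIV v"
    and T: "T \<in> bounded_operators s1 s2"
    and D: "D \<in> bounded_operators s1 s2" "\<And>x. (\<lambda>n. s2 (ip1 x (u n)) (v n)) sums D x"
    and P: "P \<in> bounded_operators s1 s1" "\<And>x. (\<lambda>n. s1 (ip1 x (u n)) (u n)) sums P x"
    and P': "\<And>y. (\<lambda>n. s2 (ip2 y (v n)) (v n)) sums P' y"
    and Y: "H1.subspace Y" "\<And>n. u n \<in> Y" "\<And>y. y \<in> Y \<Longrightarrow> P y = y"
  obtains R :: "nat \<Rightarrow> 'a \<Rightarrow> 'b" where "\<And>N. R N \<in> bounded_operators s1 s2" "\<And>N. D ` Y \<subseteq> R N ` Y"
    "\<And>x y. (\<lambda>N. ip2 (R N x) y) \<longlonglongrightarrow> ip2 (P' (T (P x))) y + ip2 (T (x - P x)) y"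
proof -
  interpret P11: hilbert_pair s1 ip1 s1 ip1 ..
  interpret P22: hilbert_pair s2 ip2 s2 ip2 ..
  interpret P21: hilbert_pair s2 ip2 s1 ip1 ..
  \<comment> \<open>\<open>a N\<close> is \<open>D\<close> outside the leading block of size
    \<open>2 * N\<close>, \<open>b N\<close> and \<open>c N\<close> are the two identity blocks, and
    \<open>d N\<close> is the compression of \<open>T\<close>.\<close>
  define a where "a = (\<lambda>N x. D x - (\<Sum>i<N+N. s2 (ip1 x (u i)) (v i)))"
  define b where "b = (\<lambda>N x. (\<Sum>i<N. s2 (ip1 x (u i)) (v (i + N))))"
  define c where "c = (\<lambda>N x. (\<Sum>i<N. s2 (ip1 x (u (i + N))) (v i)))"
  define d where "d = (\<lambda>N x. H2.proj {..<N} v (T (H1.proj {..<N} u x)))"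
  define R where "R = (\<lambda>N x. a N x + b N x + c N x + d N x + T (x - P x))"
  have R: "R N \<in> bounded_operators s1 s2" for N
  proof -
    have p2: "(\<lambda>y. H2.proj {..<N} v y) \<in> bounded_operators s2 s2"
      unfolding H2.proj_def by (intro P22.bounded_operators_sum P22.bounded_operators_rank_one)
    have p1: "(\<lambda>y. H1.proj {..<N} u y) \<in> bounded_operators s1 s1"
      unfolding H1.proj_def by (intro P11.bounded_operators_sum P11.bounded_operators_rank_one)
    have "d N \<in> bounded_operators s1 s2"
      unfolding d_def using bounded_operators_compose[OF p2 bounded_operators_compose[OF T p1]] .
    moreover have "a N \<in> bounded_operators s1 s2" "b N \<in> bounded_operators s1 s2"
        "c N \<in> bounded_operators s1 s2"
      unfolding a_def b_def c_def
      by (intro bounded_operators_diff bounded_operators_sum bounded_operators_rank_one D(1))+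
    moreover have "(\<lambda>x. T (x - P x)) = (\<lambda>x. T x - T (P x))" using bo_diff[OF T] by simp
    then have "(\<lambda>x. T (x - P x)) \<in> bounded_operators s1 s2"
      using bounded_operators_diff[OF T bounded_operators_compose[OF T P(1)]] by simp
    ultimately show ?thesis unfolding R_def by (intro bounded_operators_add)
  qed
  have Du: "D (u k) = v k" for k by (rule diagonal_apply[OF u D(2)])
  have uu: "ip1 (u i) (u j) = of_bool (i = j)" for i j using H1.orthonormalD[OF u] by simp
  have sc: "s2 (of_bool Q) y = (if Q then y else 0)" for Q y by simp
  have R_low: "R N (u k) = v (k + N) + (\<Sum>j<N. s2 (ip2 (T (u k)) (v j)) (v j))" if "k < N" for N k
    using that
    by (simp add: R_def a_def b_def c_def d_def Du uu sc H1.proj_orthonormal[OF u] Y(2,3) bo_zero[OF T]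
        H2.proj_def sum.delta)
  have R_high: "R N (u (k + N)) = v k" if "k < N" for N k
    using that
    by (simp add: R_def a_def b_def c_def d_def Du uu sc H1.proj_orthonormal[OF u] Y(2,3) bo_zero[OF T]
        H2.proj_def sum.delta)
  have cov: "D ` Y \<subseteq> R N ` Y" for N
  proof
    fix y assume "y \<in> D ` Y"
    then obtain z where z: "z \<in> Y" "y = D z" by blast
    define \<gamma> where "\<gamma> i = ip1 z (u i)" for i
    define \<beta> where "\<beta> i j = ip2 (T (u i)) (v j)" for i j
    define z' where "z' = z - H1.proj {..<N+N} u z"
    \<comment> \<open>The block matrix is inverted explicitly: \<open>R N\<close> sends the
      corrected vector \<open>u i - ...\<close> to \<open>v (i + N)\<close> and sends
      \<open>u (i + N)\<close> to \<open>v i\<close>.\<close>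
    define g where "g = z' + (\<Sum>i<N. s1 (\<gamma> (i + N)) (u i - (\<Sum>j<N. s1 (\<beta> i j) (u (j + N)))))
      + (\<Sum>i<N. s1 (\<gamma> i) (u (i + N)))"
    have z'Y: "z' \<in> Y" unfolding z'_def H1.proj_def
      by (intro H1.subspace_diff H1.subspace_sum H1.subspace_scale Y z)
    then have gY: "g \<in> Y" unfolding g_def
      by (intro H1.subspace_add H1.subspace_diff H1.subspace_sum H1.subspace_scale Y)
    have z'0: "ip1 z' (u i) = 0" if "i < N + N" for i
      unfolding z'_def using that by (intro H1.proj_residual_orth[OF H1.orthonormal_mono[OF u]]) auto
    have "R N z' = D z'"
      by (simp add: R_def a_def b_def c_def d_def z'0 H1.proj_def H2.proj_def Y(3)[OF z'Y] bo_zero[OF T])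
    also have "\<dots> = D z - (\<Sum>i<N+N. s2 (\<gamma> i) (v i))"
      by (simp add: z'_def bo_diff[OF D(1)] H1.proj_def bo_sum[OF D(1)] bo_scale[OF D(1)] Du \<gamma>_def)
    also have "\<dots> = D z - (\<Sum>i<N. s2 (\<gamma> i) (v i)) - (\<Sum>i<N. s2 (\<gamma> (i + N)) (v (i + N)))"
      by (simp add: sum_lessThan_add)
    finally have "R N g = D z"
      by (simp add: g_def bo_add[OF R] bo_sum[OF R] bo_scale[OF R] bo_diff[OF R] R_low R_high \<beta>_def)
    with z(2) gY show "y \<in> R N ` Y" by (intro image_eqI[of _ _ g]) simp_all
  qed
  have lim: "(\<lambda>N. ip2 (R N x) y) \<longlonglongrightarrow> ip2 (P' (T (P x))) y + ip2 (T (x - P x)) y" for x y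
  proof -
    have "strict_mono (\<lambda>N::nat. N + N)" by (simp add: strict_mono_def)
    from LIMSEQ_subseq_LIMSEQ[OF D(2)[of x, unfolded sums_def] this]
    have "(\<lambda>N. a N x) \<longlonglongrightarrow> D x - D x"
      unfolding a_def o_def by (intro tendsto_diff tendsto_const)
    then have "(\<lambda>N. ip2 (a N x) y) \<longlonglongrightarrow> ip2 0 y" by (intro H2.tendsto_ip tendsto_const) simp
    \<comment> \<open>Unlike \<open>c N x\<close>, the vectors \<open>b N x\<close> need not tend to
      0 in norm. Moved to the other side of the inner product, the block acts on \<open>y\<close>
      through shifted coefficients.\<close>
    moreover have "(\<lambda>N. ip2 (b N x) y) \<longlonglongrightarrow> 0"
    proof -
      have "scnj (ip2 y (v n)) = ip2 (v n) y" for n by (metis H2.ip_commute)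
      then have "ip2 (b N x) y = ip1 x (\<Sum>i<N. s1 (ip2 y (v (i + N))) (u i))" for N
        by (simp add: b_def H2.ip_sum_left H2.ip_scale_left H1.ip_sum_right H1.ip_scale_right mult.commute)
      moreover have "(\<lambda>N. ip1 x (\<Sum>i<N. s1 (ip2 y (v (i + N))) (u i))) \<longlonglongrightarrow> ip1 x 0"
        by (intro H1.tendsto_ip tendsto_const P21.shifted_coefficients_tendsto_0 u v)
      ultimately show ?thesis by simp
    qed
    moreover have "(\<lambda>N. ip2 (c N x) y) \<longlonglongrightarrow> ip2 0 y"
      unfolding c_def by (intro H2.tendsto_ip tendsto_const shifted_coefficients_tendsto_0 u v)
    \<comment> \<open>Both projections vary with \<open>N\<close>; the outer ones are contractions,
      so the inner limit can be taken first.\<close>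
    moreover have "(\<lambda>N. d N x) \<longlonglongrightarrow> P' (T (P x))"
    proof -
      have "(\<lambda>N. T (H1.proj {..<N} u x)) \<longlonglongrightarrow> T (P x)"
        using P(2)[of x] unfolding sums_def H1.proj_def
        by (rule bounded_linear.tendsto[OF bo_bounded_linear[OF T]])
      then have "(\<lambda>N. T (H1.proj {..<N} u x) - T (P x)) \<longlonglongrightarrow> 0" by (rule LIM_zero)
      then have "(\<lambda>N. norm (T (H1.proj {..<N} u x) - T (P x))) \<longlonglongrightarrow> 0" by (rule tendsto_norm_zero)
      then have "(\<lambda>N. d N x - H2.proj {..<N} v (T (P x))) \<longlonglongrightarrow> 0"
        unfolding d_def H2.proj_diff[symmetric]
        by (rule Lim_null_comparison[rotated])
          (auto intro!: always_eventually H2.norm_proj_le H2.orthonormal_mono[OF v])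
      from tendsto_add[OF this P'[of "T (P x)", unfolded sums_def]] show ?thesis
        by (simp add: H2.proj_def)
    qed
    then have "(\<lambda>N. ip2 (d N x) y) \<longlonglongrightarrow> ip2 (P' (T (P x))) y"
      by (intro H2.tendsto_ip tendsto_const)
    ultimately have "(\<lambda>N. ip2 (a N x) y + ip2 (b N x) y + ip2 (c N x) y + ip2 (d N x) y + ip2 (T (x - P x)) y)
      \<longlonglongrightarrow> ip2 0 y + 0 + ip2 0 y + ip2 (P' (T (P x))) y + ip2 (T (x - P x)) y"
      by (intro tendsto_add tendsto_const)
    then show ?thesis by (simp add: R_def H2.ip_add_left)
  qed
  from R cov lim show thesis by (rule that)
qed

end

subsection \<open>Operator ranges, width classes and the weak operator topology\<close>

context hilbert_pair
begin

context
  fixes A e u s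
  assumes ss: "singular_system A e u s"
begin

lemma subspace_range: "H2.subspace (range A)"
  unfolding H2.subspace_def
proof (intro conjI ballI allI)
  show "0 \<in> range A" by (rule range_eqI[of _ _ 0]) (simp add: bo_zero[OF ss_bo[OF ss]])
next
  fix x y assume "x \<in> range A" "y \<in> range A"
  then obtain a b where "x = A a" "y = A b" by blast
  then show "x + y \<in> range A" by (intro range_eqI[of _ _ "a + b"]) (simp add: bo_add[OF ss_bo[OF ss]])
next
  fix c x assume "x \<in> range A"
  then obtain a where "x = A a" by blast
  then show "s2 c x \<in> range A" by (intro range_eqI[of _ _ "s1 c a"]) (simp add: bo_scale[OF ss_bo[OF ss]])
qed

lemma singular_vector_in_range: "u n \<in> range A"
proof (rule range_eqI)
  show "u n = A (s1 (of_real (1 / s n)) (e n))"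
    using ss_pos[OF ss, of n] by (simp add: bo_scale[OF ss_bo[OF ss]] ss_eq[OF ss])
qed

lemma range_expansion:
  assumes "y \<in> range A"
  shows "(\<lambda>n. s2 (ip2 y (u n)) (u n)) sums y"
proof -
  from assms obtain x where x: "y = A x" by blast
  have "ip2 (A x) (u n) = of_real (s n) * ip1 x (e n)" for n
  proof -
    have "(\<lambda>k. ip2 (s2 (of_real (s k) * ip1 x (e k)) (u k)) (u n)) sums ip2 (A x) (u n)"
      by (rule bounded_linear.sums[OF H2.bounded_linear_ip_left singular_expansion[OF ss]])
    moreover have "(\<lambda>k. ip2 (s2 (of_real (s k) * ip1 x (e k)) (u k)) (u n))
        = (\<lambda>k. if k = n then of_real (s k) * ip1 x (e k) else 0)"
      by (auto simp: H2.ip_scale_left H2.orthonormalD[OF ss_u[OF ss, of UNIV]])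
    ultimately show ?thesis
      using sums_single[of n "\<lambda>k. of_real (s k) * ip1 x (e k)"] sums_unique2 by simp
  qed
  then show ?thesis using singular_expansion[OF ss, of x] by (simp add: x)
qed

text \<open>Every vector of the range is the sum of its expansion in \<open>u\<close>, and the fixed
  points of a continuous map form a closed set.\<close>

lemma fixed_on_closure_range:
  assumes P: "bounded_linear P" and fixed: "\<And>c n. P (s2 c (u n)) = s2 c (u n)"
    and y: "y \<in> closure (range A)"
  shows "P y = y"
proof -
  have "closed {y. P y = y}"
    by (intro closed_Collect_eq linear_continuous_on P continuous_on_id)
  moreover have "range A \<subseteq> {y. P y = y}"
  proof safe
    fix x
    have "(\<lambda>n. P (s2 (ip2 (A x) (u n)) (u n))) sums P (A x)"
      by (intro bounded_linear.sums[OF P] range_expansion) simp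
    then show "P (A x) = A x"
      using range_expansion[of "A x"] sums_unique2 by (fastforce simp: fixed)
  qed
  ultimately show ?thesis using y closure_minimal by blast
qed

lemma orthogonal_closure_range:
  assumes "\<And>n. ip2 (u n) z = 0" "y \<in> closure (range A)"
  shows "ip2 y z = 0"
proof -
  have "closed {y. ip2 y z = 0}"
    by (intro closed_Collect_eq linear_continuous_on H2.bounded_linear_ip_left continuous_on_const)
  moreover have "range A \<subseteq> {y. ip2 y z = 0}"
  proof safe
    fix x
    have "(\<lambda>n. ip2 (s2 (ip2 (A x) (u n)) (u n)) z) sums ip2 (A x) z"
      by (intro bounded_linear.sums[OF H2.bounded_linear_ip_left] range_expansion) simp
    then have "(\<lambda>n. 0) sums ip2 (A x) z" by (simp add: H2.ip_scale_left assms(1))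
    then show "ip2 (A x) z = 0" using sums_unique2 sums_zero by blast
  qed
  ultimately show ?thesis using assms(2) closure_minimal by blast
qed

text \<open>\<open>Q\<close> is the orthogonal projection onto the complement of the closed range.
  Having that closure as kernel, it serves as the quotient map.\<close>

lemma projection_complement_range:
  obtains Q where "Q \<in> bounded_operators s2 s2" "\<And>y. Q y = 0 \<longleftrightarrow> y \<in> closure (range A)"
    "\<And>y n. ip2 (Q y) (u n) = 0" "\<And>y. y - Q y \<in> closure (range A)"
proof -
  interpret P22: hilbert_pair s2 ip2 s2 ip2 ..
  note u = ss_u[OF ss, of UNIV]
  from P22.diagonal_operator[OF u u, of "\<lambda>_. 1" 1] obtain P where
    P: "P \<in> bounded_operators s2 s2" "\<And>y. (\<lambda>n. s2 (ip2 y (u n)) (u n)) sums P y" by auto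
  have Pu: "P (s2 c (u n)) = s2 c (u n)" for c n
    by (simp add: P22.bo_scale[OF P(1)] P22.diagonal_apply[OF u P(2)])
  have Pcl: "P y \<in> closure (range A)" for y
  proof (rule closed_sequentially[OF closed_closure])
    show "(\<lambda>n. \<Sum>i<n. s2 (ip2 y (u i)) (u i)) \<longlonglongrightarrow> P y" using P(2) by (simp add: sums_def)
    have "(\<Sum>i<n. s2 (ip2 y (u i)) (u i)) \<in> range A" for n
      by (intro H2.subspace_sum H2.subspace_scale subspace_range singular_vector_in_range)
    then show "(\<Sum>i<n. s2 (ip2 y (u i)) (u i)) \<in> closure (range A)" for n
      using closure_subset by blast
  qed
  have ipP: "ip2 (P y) (u n) = ip2 y (u n)" for y n
  proof -
    have "(\<lambda>k. ip2 (s2 (ip2 y (u k)) (u k)) (u n)) sums ip2 (P y) (u n)"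
      by (rule bounded_linear.sums[OF H2.bounded_linear_ip_left P(2)])
    moreover have "(\<lambda>k. ip2 (s2 (ip2 y (u k)) (u k)) (u n)) = (\<lambda>k. if k = n then ip2 y (u k) else 0)"
      by (auto simp: H2.ip_scale_left H2.orthonormalD[OF u])
    ultimately show ?thesis
      using sums_single[of n "\<lambda>k. ip2 y (u k)"] sums_unique2 by simp
  qed
  show thesis
  proof (rule that[of "\<lambda>y. y - P y"])
    show "(\<lambda>y. y - P y) \<in> bounded_operators s2 s2"
      by (intro P22.bounded_operators_diff P P22.bounded_operatorsI[of "\<lambda>x. x" 1]) auto
    show "y - P y = 0 \<longleftrightarrow> y \<in> closure (range A)" for y
      using Pcl[of y] fixed_on_closure_range[OF P22.bo_bounded_linear[OF P(1)] Pu] by auto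
  qed (simp_all add: H2.ip_diff_left ipP Pcl)
qed

text \<open>Gram-Schmidt is applied to the images of \<open>B\<close> under the projection
  \<open>Q\<close>, so the \<open>w i\<close> span the same subspace as these images.\<close>

lemma orthonormal_complement_basis:
  assumes "finite B"
  obtains r w where "r \<le> card B" "H2.orthonormal {..<r} w" "\<And>i n. i < r \<Longrightarrow> ip2 (u n) (w i) = 0"
    "\<And>b. b \<in> B \<Longrightarrow> \<exists>p\<in>H2.span (w ` {..<r}). b - p \<in> closure (range A)"
proof -
  obtain Q where Q: "\<And>y n. ip2 (Q y) (u n) = 0" "\<And>y. y - Q y \<in> closure (range A)"
    using projection_complement_range by metis
  from H2.gram_schmidt[of "Q ` B"] assms obtain r w where
    w: "r \<le> card (Q ` B)" "H2.orthonormal {..<r} w" "H2.span (w ` {..<r}) = H2.span (Q ` B)" by blast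
  show thesis
  proof (rule that)
    show "r \<le> card B" using w(1) card_image_le[OF assms, of Q] by linarith
    show "H2.orthonormal {..<r} w" by fact
    fix i n assume "i < r"
    then have "w i \<in> H2.span (Q ` B)" unfolding w(3)[symmetric] by (intro H2.span_base) auto
    then show "ip2 (u n) (w i) = 0"
      by (rule H2.ip_span_eq_0[rotated]) (use Q(1) H2.ip_eq_0_commute in blast)
  next
    fix b assume "b \<in> B"
    then have "Q b \<in> H2.span (w ` {..<r})" unfolding w(3) by (intro H2.span_base) auto
    with Q(2) show "\<exists>p\<in>H2.span (w ` {..<r}). b - p \<in> closure (range A)" by blast
  qed
qed

lemma singular_values_in_width_class:
  assumes "compact_operator s1 s2 A" "infinite_dimensional s2 (range A)"
  shows "s \<in> width_class s1 s2 (range A)"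
proof -
  have "kolmogorov_width s2 (A ` cball 0 1) = s"
    using kolmogorov_width_singular[OF ss] by blast
  moreover have "majorizes s s" by (auto simp: majorizes_def intro: exI[of _ 1])
  ultimately have "seq_equivalent s (kolmogorov_width s2 (A ` cball 0 1))"
    by (simp add: seq_equivalent_def ss_pos[OF ss])
  moreover have "generating_ellipsoid s1 s2 (range A) (A ` cball 0 1)"
    using assms by (auto simp: generating_ellipsoid_def)
  ultimately show ?thesis unfolding width_class_def by blast
qed

end

text \<open>The identity is a covering operator, and \<open>covering_bound\<close> applies to it
  with no additional vectors. This makes the width class independent of the generating
  operator.\<close>

lemma range_subset_singular_values:
  assumes ssA: "singular_system A e u s" and ssB: "singular_system B f v t" and "range B \<subseteq> range A"
  shows "majorizes s t"
proof -
  interpret T: hilbert_triple s1 ip1 s2 ip2 s2 ip2 ..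
  have id: "(\<lambda>x. x) \<in> bounded_operators s2 s2" by (intro T.P12.bounded_operatorsI[of _ 1]) auto
  have cov: "range B \<subseteq> (\<lambda>x. x) ` range A" using assms(3) by simp
  obtain C where "C > 0" "\<And>n. t n \<le> C * s (n + 0)"
    by (rule T.covering_bound[OF ssA ssB id cov, where m = 0]) auto
  then show ?thesis unfolding majorizes_def by auto
qed

end

lemma majorizes_trans:
  assumes "majorizes a b" "majorizes b c"
  shows "majorizes a c"
proof -
  from assms obtain C D where C: "C > 0" "\<And>n. b n \<le> C * a n" and D: "D > 0" "\<And>n. c n \<le> D * b n"
    unfolding majorizes_def by blast
  have "c n \<le> D * C * a n" for n
    using order_trans[OF D(2) mult_left_mono[OF C(2) less_imp_le[OF D(1)]], of n] by (simp add: mult.assoc)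
  with C(1) D(1) show ?thesis unfolding majorizes_def by (intro exI[of _ "D * C"]) auto
qed

lemma majorizes_left_shift: "majorizes a b \<Longrightarrow> majorizes (left_shift k a) (left_shift k b)"
  by (auto simp: majorizes_def left_shift_def)

section \<open>Representatives of width classes and weak neighbourhoods\<close>

context hilbert_pair
begin

text \<open>A member of the class comes from some operator with the same range; the two inclusions
  of ranges make its singular values equivalent to \<open>s\<close>.\<close>

lemma width_class_equivalent:
  assumes ss: "singular_system A e u s" and a: "a \<in> width_class s1 s2 (range A)"
  shows "majorizes a s" "majorizes s a" "0 < a n"
proof -
  from a obtain B where B: "compact_operator s1 s2 B" "infinite_dimensional s2 (range B)"
    "range A = range B" and eq: "seq_equivalent a (kolmogorov_width s2 (B ` cball 0 1))"
    by (auto simp: width_class_def generating_ellipsoid_def)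
  from singular_system_exists[OF B(1,2)] obtain f v t where t: "singular_system B f v t" .
  have "kolmogorov_width s2 (B ` cball 0 1) = t"
    using kolmogorov_width_singular[OF t] by blast
  with eq have "majorizes a t" "majorizes t a" "\<forall>n. 0 < a n" by (auto simp: seq_equivalent_def)
  moreover have "majorizes s t" "majorizes t s"
    using range_subset_singular_values[OF ss t] range_subset_singular_values[OF t ss] B(3) by auto
  ultimately show "majorizes a s" "majorizes s a" "0 < a n" using majorizes_trans by blast+
qed

text \<open>The topology is pulled back from the product topology along
  \<open>T \<mapsto> (\<lambda>(x, y). ip2 (T x) y)\<close>, so a basic neighbourhood restricts only
  finitely many pairs and one tolerance serves all of them.\<close>

lemma weak_closure_iff:
  assumes "S \<subseteq> bounded_operators s1 s2"
  shows "T \<in> weak_operator_topology s1 s2 ip2 closure_of S \<longleftrightarrow>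
    T \<in> bounded_operators s1 s2 \<and>
    (\<forall>F \<epsilon>. finite F \<longrightarrow> 0 < \<epsilon> \<longrightarrow> (\<exists>R\<in>S. \<forall>(x, y)\<in>F. norm (ip2 (R x) y - ip2 (T x) y) < \<epsilon>))"
    (is "?L \<longleftrightarrow> ?T \<and> ?R")
proof -
  let ?B = "bounded_operators s1 s2"
  let ?f = "\<lambda>T (x, y). ip2 (T x) y"
  have openin: "openin (weak_operator_topology s1 s2 ip2) U \<longleftrightarrow> (\<exists>V. open V \<and> U = ?f -` V \<inter> ?B)" for U
    by (simp add: weak_operator_topology_def openin_pullback_topology)
  have top: "topspace (weak_operator_topology s1 s2 ip2) = ?B"
    by (simp add: weak_operator_topology_def topspace_pullback_topology)
  show ?thesis
  proof (intro iffI conjI)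
    assume ?L
    then show ?T by (simp add: in_closure_of top)
    from \<open>?L\<close> have cl: "\<exists>R. R \<in> S \<and> R \<in> U"
      if "openin (weak_operator_topology s1 s2 ip2) U" "T \<in> U" for U
      using that by (auto simp: in_closure_of)
    show ?R
    proof (intro allI impI)
      fix F :: "('a \<times> 'b) set" and \<epsilon> :: real assume F: "finite F" "0 < \<epsilon>"
      define V where "V = (\<Inter>p\<in>F. (\<lambda>g. g p) -` ball (?f T p) \<epsilon>)"
      have "open V" unfolding V_def using F(1)
        by (intro open_INT ballI open_vimage open_ball continuous_on_product_coordinates)
      then have op: "openin (weak_operator_topology s1 s2 ip2) (?f -` V \<inter> ?B)"
        unfolding openin by blast
      have "T \<in> ?f -` V \<inter> ?B" using \<open>?T\<close> F(2) by (auto simp: V_def)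
      from cl[OF op this] obtain R where "R \<in> S" "?f R \<in> V" by auto
      then show "\<exists>R\<in>S. \<forall>(x, y)\<in>F. norm (ip2 (R x) y - ip2 (T x) y) < \<epsilon>"
        by (intro bexI[of _ R]) (auto simp: V_def dist_norm norm_minus_commute)
    qed
  next
    assume *: "?T \<and> ?R"
    show ?L
      unfolding in_closure_of top
    proof (intro conjI allI impI)
      fix U assume U: "T \<in> U \<and> openin (weak_operator_topology s1 s2 ip2) U"
      then obtain V where V: "open V" "U = ?f -` V \<inter> ?B" unfolding openin by blast
      have "openin (product_topology (\<lambda>_. euclidean) UNIV) V"
        using V(1) by (simp add: open_fun_def)
      from product_topology_open_contains_basis[OF this, of "?f T"] U V(2)
      obtain X where X: "?f T \<in> (\<Pi>\<^sub>E i\<in>UNIV. X i)" "\<And>i. open (X i)"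
        "finite {i. X i \<noteq> UNIV}" "(\<Pi>\<^sub>E i\<in>UNIV. X i) \<subseteq> V" by auto
      define F where "F = {i. X i \<noteq> UNIV}"
      have "\<forall>p. \<exists>\<epsilon>>0. ball (?f T p) \<epsilon> \<subseteq> X p"
        using X(1,2) by (metis PiE_mem UNIV_I open_contains_ball)
      from choice[OF this] obtain \<delta> where \<delta>: "\<And>p. \<delta> p > 0" "\<And>p. ball (?f T p) (\<delta> p) \<subseteq> X p" by blast
      \<comment> \<open>The entry 1 covers the case that \<open>F\<close> is empty.\<close>
      define \<epsilon> where "\<epsilon> = Min (insert 1 (\<delta> ` F))"
      have fin: "finite F" using X(3) by (simp add: F_def)
      then have \<epsilon>: "\<epsilon> > 0" "\<And>p. p \<in> F \<Longrightarrow> \<epsilon> \<le> \<delta> p" using \<delta>(1) by (auto simp: \<epsilon>_def)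
      from * fin \<epsilon>(1) obtain R where R: "R \<in> S" "\<forall>(x, y)\<in>F. norm (ip2 (R x) y - ip2 (T x) y) < \<epsilon>"
        by blast
      have "?f R p \<in> X p" for p
      proof (cases "p \<in> F")
        case True
        then have "?f R p \<in> ball (?f T p) (\<delta> p)"
          using R(2) \<epsilon>(2)[OF True] by (fastforce simp: dist_norm norm_minus_commute)
        then show ?thesis using \<delta>(2) by blast
      qed (simp add: F_def)
      then have "?f R \<in> V" using X(4) by blast
      then have "R \<in> U" using V(2) R(1) assms by auto
      with R(1) show "\<exists>y. y \<in> S \<and> y \<in> U" by blast
    qed (use * in blast)
  qed
qed

end

section \<open>Covering operators in a given weak neighbourhood\<close>

context hilbert_triple
begin

text \<open>The swapped operators converge weakly to \<open>T\<close> compressed by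
  \<open>P'\<close>, which fixes \<open>M\<close>. The compression is invisible if \<open>T\<close>
  maps the first range into \<open>M\<close>, or if every test vector lies in \<open>M\<close>. The
  first alternative serves the case of bounded dimension modulo the closure, the second the case
  where all shifts majorize.\<close>

theorem covering_approximation:
  assumes ss1: "P01.singular_system A1 e u s" and ss2: "P02.singular_system A2 f v t"
    and T: "T \<in> bounded_operators s1 s2"
    and w: "H2.orthonormal {..<r} w" "\<And>i n. i < r \<Longrightarrow> ip2 (v n) (w i) = 0"
    and C: "\<And>n. t n \<le> C * s (n + r)"
    and M: "M = {y. \<exists>p\<in>H2.span (w ` {..<r}). y - p \<in> closure (range A2)}"
    and F: "finite F" "\<epsilon> > 0" "T ` range A1 \<subseteq> M \<or> snd ` F \<subseteq> M"
  shows "\<exists>R\<in>range_covering s1 s2 (range A1) (range A2).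
    \<forall>(x, y)\<in>F. norm (ip2 (R x) y - ip2 (T x) y) < \<epsilon>"
proof -
  interpret P11: hilbert_pair s1 ip1 s1 ip1 ..
  interpret P22: hilbert_pair s2 ip2 s2 ip2 ..
  interpret P00: hilbert_pair s0 ip0 s0 ip0 ..
  \<comment> \<open>Putting \<open>r\<close> vectors in front pairs \<open>v n\<close> with
    \<open>u (n + r)\<close>, which matches the hypothesis
    \<open>t n \<le> C * s (n + r)\<close>.\<close>
  define v' where "v' i = (if i < r then w i else v (i - r))" for i
  note u = P01.ss_u[OF ss1, of UNIV] and v = P02.ss_u[OF ss2, of UNIV]
  have "ip2 (w i) (v n) = 0" if "i < r" for i n
    using w(2)[OF that] H2.ip_eq_0_commute by blast
  then have v': "H2.orthonormal UNIV v'"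
    using H2.orthonormalD[OF w(1)] H2.orthonormalD[OF v] w(2)
    by (auto simp: H2.orthonormal_def v'_def)
  from P12.diagonal_operator[OF u v', of "\<lambda>_. 1" 1] obtain D where
    D: "D \<in> bounded_operators s1 s2" "\<And>x. (\<lambda>n. s2 (ip1 x (u n)) (v' n)) sums D x" by auto
  from P11.diagonal_operator[OF u u, of "\<lambda>_. 1" 1] obtain P where
    P: "P \<in> bounded_operators s1 s1" "\<And>x. (\<lambda>n. s1 (ip1 x (u n)) (u n)) sums P x" by auto
  from P22.diagonal_operator[OF v' v', of "\<lambda>_. 1" 1] obtain P' where
    P': "P' \<in> bounded_operators s2 s2" "\<And>x. (\<lambda>n. s2 (ip2 x (v' n)) (v' n)) sums P' x" by auto
  have Y: "H1.subspace (range A1)" "\<And>n. u n \<in> range A1" "\<And>y. y \<in> range A1 \<Longrightarrow> P y = y"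
    using P01.subspace_range[OF ss1] P01.singular_vector_in_range[OF ss1]
      sums_unique2[OF P(2) P01.range_expansion[OF ss1]] by auto
  from P12.partial_swap_approximation[OF u v' T D P P'(2) Y] obtain R where
    R: "\<And>N. R N \<in> bounded_operators s1 s2" "\<And>N. D ` range A1 \<subseteq> R N ` range A1"
      "\<And>x y. (\<lambda>N. ip2 (R N x) y) \<longlonglongrightarrow> ip2 (P' (T (P x))) y + ip2 (T (x - P x)) y" by blast
  have "range A2 \<subseteq> D ` range A1"
  proof safe
    fix h
    \<comment> \<open>\<open>D\<close> sends \<open>A1 (e (n + r))\<close> to
      \<open>s (n + r)\<close> times \<open>v n\<close>; this multiplier changes the factor to
      \<open>t n\<close> and is bounded by \<open>C\<close>.\<close>
    define m where "m n = (of_real (t n / s (n + r)) :: 'k)" for n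
    have s: "0 < s n" "s n \<noteq> 0" for n using P01.ss_pos[OF ss1, of n] by auto
    have "norm (m n) \<le> C" for n
      using C[of n] s(1)[of "n + r"] P02.ss_pos[OF ss2, of n]
      by (simp add: m_def norm_divide divide_le_eq)
    moreover have "H0.orthonormal UNIV (\<lambda>n. e (n + r))"
      using H0.orthonormalD[OF P01.ss_e[OF ss1, of UNIV]] by (auto simp: H0.orthonormal_def)
    ultimately have "summable (\<lambda>n. s0 (m n * ip0 h (f n)) (e (n + r)))"
      by (intro P00.diagonal_summable[OF P02.ss_e[OF ss2]])
    then obtain g where g: "(\<lambda>n. s0 (m n * ip0 h (f n)) (e (n + r))) sums g"
      by (auto simp: summable_def)
    have bl: "bounded_linear (\<lambda>x. D (A1 x))"
      by (intro bounded_linear_compose[of D A1] P12.bo_bounded_linear[OF D(1)]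
          P01.bo_bounded_linear[OF P01.ss_bo[OF ss1]])
    have "D (A1 (s0 (m n * ip0 h (f n)) (e (n + r)))) = s2 (of_real (t n) * ip0 h (f n)) (v n)" for n
      using s(2)[of "n + r"]
      by (simp add: P01.bo_scale[OF P01.ss_bo[OF ss1]] P12.bo_scale[OF D(1)] P01.ss_eq[OF ss1]
          P12.diagonal_apply[OF u D(2)] v'_def m_def)
    with bounded_linear.sums[OF bl g]
    have "(\<lambda>n. s2 (of_real (t n) * ip0 h (f n)) (v n)) sums D (A1 g)" by simp
    with P02.singular_expansion[OF ss2, of h] have "A2 h = D (A1 g)" by (rule sums_unique2)
    then show "A2 h \<in> D ` range A1" by simp
  qed
  from order_trans[OF this R(2)] R(1)
  have RC: "R N \<in> range_covering s1 s2 (range A1) (range A2)" for N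
    by (simp add: range_covering_def)
  have P'M: "P' y = y" if "y \<in> M" for y
  proof -
    from that obtain p where p: "p \<in> H2.span (w ` {..<r})" "y - p \<in> closure (range A2)"
      by (auto simp: M)
    have "P' p = p" using p(1)
    proof (induction rule: H2.span_induct_alt)
      case (step c x z)
      then obtain i where "i < r" "x = w i" by auto
      then have "P' x = x" using P22.diagonal_apply[OF v' P'(2), of i] by (simp add: v'_def)
      with step show ?case by (simp add: P22.bo_add[OF P'(1)] P22.bo_scale[OF P'(1)])
    qed (simp add: P22.bo_zero[OF P'(1)])
    moreover have "P' (v n) = v n" for n
      using P22.diagonal_apply[OF v' P'(2), of "n + r"] by (simp add: v'_def)
    then have "P' (y - p) = y - p"
      by (intro P02.fixed_on_closure_range[OF ss2 P22.bo_bounded_linear[OF P'(1)] _ p(2)])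
        (simp add: P22.bo_scale[OF P'(1)])
    ultimately show ?thesis by (simp add: P22.bo_diff[OF P'(1)])
  qed
  have limit: "ip2 (P' (T (P x))) y + ip2 (T (x - P x)) y = ip2 (T x) y" if "(x, y) \<in> F" for x y
  proof -
    \<comment> \<open>Either \<open>T (P x)\<close> is a limit of vectors fixed by
      \<open>P'\<close>, or \<open>P'\<close> is moved to \<open>y\<close> by self-adjointness and
      disappears there.\<close>
    have "ip2 (P' (T (P x))) y = ip2 (T (P x)) y"
      using F(3)
    proof
      assume TM: "T ` range A1 \<subseteq> M"
      have lim: "(\<lambda>n. T (\<Sum>i<n. s1 (ip1 x (u i)) (u i))) \<longlonglongrightarrow> T (P x)"
        using P(2)[of x] unfolding sums_def
        by (rule bounded_linear.tendsto[OF P12.bo_bounded_linear[OF T]])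
      have "(\<Sum>i<n. s1 (ip1 x (u i)) (u i)) \<in> range A1" for n
        by (intro H1.subspace_sum H1.subspace_scale Y)
      then have "P' (T (\<Sum>i<n. s1 (ip1 x (u i)) (u i))) = T (\<Sum>i<n. s1 (ip1 x (u i)) (u i))" for n
        using TM by (intro P'M) blast
      with bounded_linear.tendsto[OF P22.bo_bounded_linear[OF P'(1)] lim] lim
      have "P' (T (P x)) = T (P x)" by (auto intro: LIMSEQ_unique)
      then show ?thesis by simp
    next
      assume "snd ` F \<subseteq> M"
      with that have "P' y = y" by (intro P'M) force
      have "(\<lambda>n. ip2 (H2.proj {..<n} v' z) y) \<longlonglongrightarrow> ip2 (P' z) y" for z
        using P'(2)[of z] unfolding sums_def H2.proj_def by (intro H2.tendsto_ip tendsto_const)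
      moreover have "(\<lambda>n. ip2 z (H2.proj {..<n} v' y)) \<longlonglongrightarrow> ip2 z (P' y)" for z
        using P'(2)[of y] unfolding sums_def H2.proj_def by (intro H2.tendsto_ip tendsto_const)
      ultimately have "ip2 (P' z) y = ip2 z (P' y)" for z
        unfolding H2.proj_self_adjoint by (rule LIMSEQ_unique)
      with \<open>P' y = y\<close> show ?thesis by simp
    qed
    then show ?thesis by (simp add: P12.bo_diff[OF T] H2.ip_diff_left)
  qed
  have "\<forall>\<^sub>F N in sequentially. \<forall>p\<in>F. norm (ip2 (R N (fst p)) (snd p) - ip2 (T (fst p)) (snd p)) < \<epsilon>"
  proof (intro eventually_ball_finite F ballI)
    fix p assume "p \<in> F"
    with R(3)[of "fst p" "snd p"] limit[of "fst p" "snd p"]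
    have "(\<lambda>N. ip2 (R N (fst p)) (snd p)) \<longlonglongrightarrow> ip2 (T (fst p)) (snd p)" by simp
    from tendstoD[OF this F(2)]
    show "\<forall>\<^sub>F N in sequentially. norm (ip2 (R N (fst p)) (snd p) - ip2 (T (fst p)) (snd p)) < \<epsilon>"
      by (simp add: dist_norm)
  qed
  then obtain N where "\<forall>p\<in>F. norm (ip2 (R N (fst p)) (snd p) - ip2 (T (fst p)) (snd p)) < \<epsilon>"
    using eventually_happens trivial_limit_sequentially by blast
  with RC[of N] show ?thesis by (intro bexI[of _ "R N"]) auto
qed

end

subsection \<open>Dimension modulo a closed subspace and the main theorem\<close>

context hilbert_space
begin

context
  fixes Q :: "'a \<Rightarrow> 'a" and W :: "'a set"
  assumes Q: "Q \<in> bounded_operators scale scale" and W: "\<And>y. Q y = 0 \<longleftrightarrow> y \<in> W"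
begin

interpretation QQ: hilbert_pair scale ip scale ip ..

text \<open>A linear map with kernel \<open>W\<close> realizes the quotient by \<open>W\<close>
  inside the space itself, so that dimensions modulo \<open>W\<close> become dimensions of images
  under \<open>Q\<close>.\<close>

lemma coset_eq_iff: "x +o W = y +o W \<longleftrightarrow> Q x = Q y"
proof
  assume eq: "x +o W = y +o W"
  have "0 \<in> W" using W[of 0] QQ.bo_zero[OF Q] by simp
  then have "x \<in> x +o W" by (force simp: elt_set_plus_def)
  then have "x \<in> y +o W" using eq by simp
  then obtain b where b: "b \<in> W" "x = y + b" by (auto simp: elt_set_plus_def)
  then show "Q x = Q y" using W[of b] by (simp add: QQ.bo_add[OF Q])
next
  have *: "x +o W \<subseteq> y +o W" if "Q x = Q y" for x y
  proof
    fix z assume "z \<in> x +o W"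
    then obtain b where b: "b \<in> W" "z = x + b" by (auto simp: elt_set_plus_def)
    then have "Q (z - y) = 0"
      using that W[of b] by (simp add: QQ.bo_add[OF Q] QQ.bo_diff[OF Q])
    then have "z - y \<in> W" using W by blast
    then have "y + (z - y) \<in> y +o W" unfolding elt_set_plus_def by blast
    then show "z \<in> y +o W" by simp
  qed
  assume "Q x = Q y"
  then show "x +o W = y +o W" using *[of x y] *[of y x] by auto
qed

lemma dim_modulo_leD:
  assumes "dim_modulo_le scale W V k"
  obtains B where "finite B" "card B \<le> k" "B \<subseteq> V" "\<And>x. x \<in> V \<Longrightarrow> \<exists>y\<in>span B. x - y \<in> W"
proof -
  from assms obtain B where B: "finite B" "card B \<le> k" "B \<subseteq> V"
    "(\<lambda>x. x +o W) ` V = (\<lambda>x. x +o W) ` span B"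
    by (auto simp: dim_modulo_le_def finite_basis_modulo_def)
  have "\<exists>y\<in>span B. x - y \<in> W" if "x \<in> V" for x
  proof -
    from that B(4) obtain y where y: "y \<in> span B" "x +o W = y +o W" by blast
    then have "Q (x - y) = 0" by (simp add: coset_eq_iff QQ.bo_diff[OF Q])
    with y W show ?thesis by blast
  qed
  with B that show thesis by blast
qed

text \<open>If a maximal independent subset of the image had at most \<open>k\<close> elements,
  preimages of them in \<open>V\<close> would form a basis modulo \<open>W\<close>.\<close>

lemma not_dim_modulo_leD:
  assumes V: "subspace V" and "\<not> dim_modulo_le scale W V k"
  obtains C where "finite C" "card C = Suc k" "C \<subseteq> Q ` V" "independent C"
proof -
  obtain C0 where C0: "C0 \<subseteq> Q ` V" "independent C0" "Q ` V \<subseteq> span C0"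
    using maximal_independent_subset by blast
  have "\<not> (finite C0 \<and> card C0 \<le> k)"
  proof
    assume fin: "finite C0 \<and> card C0 \<le> k"
    have "\<forall>c\<in>C0. \<exists>x. x \<in> V \<and> Q x = c" using C0(1) by blast
    from bchoice[OF this] obtain g where g: "\<And>c. c \<in> C0 \<Longrightarrow> g c \<in> V" "\<And>c. c \<in> C0 \<Longrightarrow> Q (g c) = c"
      by blast
    have inj: "inj_on g C0" using g(2) by (metis inj_onI)
    let ?B = "g ` C0"
    have BV: "?B \<subseteq> V" using g(1) by blast
    then have spV: "span ?B \<subseteq> V" using V span_minimal by blast
    have QB: "Q ` ?B = C0" using g(2) by (force simp: image_image)
    have "finite_basis_modulo scale W V ?B"
      unfolding finite_basis_modulo_def
    proof (intro conjI allI impI)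
      show "finite ?B" using fin by blast
      show "?B \<subseteq> V" by fact
      fix c assume "(\<Sum>b\<in>?B. scale (c b) b) +o W = 0 +o W"
      then have "Q (\<Sum>b\<in>?B. scale (c b) b) = 0" by (simp only: coset_eq_iff QQ.bo_zero[OF Q])
      then have "(\<Sum>x\<in>C0. scale (c (g x)) x) = 0"
        by (simp add: QQ.bo_sum[OF Q] QQ.bo_scale[OF Q] sum.reindex[OF inj] g(2))
      then show "\<forall>b\<in>?B. c b = 0"
        using C0(2) fin independentD[of C0 C0 "\<lambda>x. c (g x)"] by blast
    next
      show "(\<lambda>x. x +o W) ` V = (\<lambda>x. x +o W) ` span ?B"
      proof
        show "(\<lambda>x. x +o W) ` V \<subseteq> (\<lambda>x. x +o W) ` span ?B"
        proof safe
          fix x assume "x \<in> V"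
          then have "Q x \<in> span (Q ` ?B)" using C0(3) QB by auto
          also have "span (Q ` ?B) = Q ` span ?B"
            using Q by (intro module_hom.span_image) (auto simp: bounded_operators_def linear_iff_module_hom)
          finally obtain y where "y \<in> span ?B" "Q x = Q y" by blast
          then show "x +o W \<in> (\<lambda>x. x +o W) ` span ?B" using coset_eq_iff by blast
        qed
      qed (use spV in blast)
    qed
    moreover have "card ?B \<le> k" using fin card_image_le[of C0 g] by auto
    ultimately show False using assms(2) unfolding dim_modulo_le_def by blast
  qed
  then have "\<exists>C\<subseteq>C0. finite C \<and> card C = Suc k"
    using infinite_arbitrarily_large[of C0 "Suc k"] obtain_subset_with_card_n[of "Suc k" C0]
    by (cases "finite C0") (metis not_less_eq_eq card_ge_0_finite zero_less_Suc)+
  then obtain C where "C \<subseteq> C0" "finite C" "card C = Suc k" by blast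
  with C0 independent_mono show thesis by (intro that[of C]) auto
qed

end
end

section \<open>The weak closure of the set of covering operators\<close>

context hilbert_triple
begin

text \<open>The singular values represent the two classes, and all other representatives are
  equivalent to them.\<close>

lemma class_majorizes_iff:
  assumes ss1: "P01.singular_system A1 e u s" and ss2: "P02.singular_system A2 f v t"
    and cpt: "compact_operator s0 s1 A1" "infinite_dimensional s1 (range A1)"
      "compact_operator s0 s2 A2" "infinite_dimensional s2 (range A2)"
  shows "class_majorizes (left_shift k ` width_class s0 s1 (range A1)) (width_class s0 s2 (range A2))
    \<longleftrightarrow> majorizes (left_shift k s) t"
proof
  assume "class_majorizes (left_shift k ` width_class s0 s1 (range A1)) (width_class s0 s2 (range A2))"
  then obtain a b where ab: "a \<in> width_class s0 s1 (range A1)" "b \<in> width_class s0 s2 (range A2)"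
    "majorizes (left_shift k a) b" by (auto simp: class_majorizes_def)
  from P01.width_class_equivalent(2)[OF ss1 ab(1)] P02.width_class_equivalent(1)[OF ss2 ab(2)] ab(3)
  show "majorizes (left_shift k s) t"
    using majorizes_trans majorizes_left_shift by blast
next
  assume "majorizes (left_shift k s) t"
  then show "class_majorizes (left_shift k ` width_class s0 s1 (range A1)) (width_class s0 s2 (range A2))"
    using P01.singular_values_in_width_class[OF ss1 cpt(1,2)] P02.singular_values_in_width_class[OF ss2 cpt(3,4)]
    unfolding class_majorizes_def by blast
qed

context
  fixes A1 e u s A2 f v t
  assumes ss1: "P01.singular_system A1 e u s" and ss2: "P02.singular_system A2 f v t"
begin

abbreviation WR :: "('a \<Rightarrow> 'b) set" where
  "WR \<equiv> weak_range_covering s1 s2 ip2 (range A1) (range A2)"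

lemma range_covering_subset: "range_covering s1 s2 (range A1) (range A2) \<subseteq> bounded_operators s1 s2"
  by (auto simp: range_covering_def)

lemma weak_range_covering_iff:
  "T \<in> WR \<longleftrightarrow> T \<in> bounded_operators s1 s2 \<and>
    (\<forall>F \<epsilon>. finite F \<longrightarrow> 0 < \<epsilon> \<longrightarrow> (\<exists>R\<in>range_covering s1 s2 (range A1) (range A2).
      \<forall>(x, y)\<in>F. norm (ip2 (R x) y - ip2 (T x) y) < \<epsilon>))"
  unfolding weak_range_covering_def by (rule P12.weak_closure_iff[OF range_covering_subset])

lemma majorizes_shift_mono:
  assumes "majorizes (left_shift k s) t" "r \<le> k"
  obtains C where "\<And>n. t n \<le> C * s (n + r)"
proof -
  from assms(1) obtain C where C: "C > 0" "\<And>n. t n \<le> C * s (n + k)"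
    by (auto simp: majorizes_def left_shift_def)
  have "C * s (n + k) \<le> C * s (n + r)" for n
    using C(1) assms(2) P01.ss_decseq[OF ss1] by (intro mult_left_mono) (auto simp: decseq_def)
  from order_trans[OF C(2) this] show thesis by (rule that)
qed

text \<open>A weak neighbourhood involves finitely many test vectors \<open>y\<close>, whose
  components orthogonal to the second range span a space of finite dimension \<open>r\<close>. This
  \<open>r\<close> grows with the neighbourhood, which is why all shifts occur.\<close>

lemma weak_range_covering_all:
  assumes "\<And>k. majorizes (left_shift k s) t"
  shows "WR = bounded_operators s1 s2"
proof
  show "WR \<subseteq> bounded_operators s1 s2" using weak_range_covering_iff by blast
  show "bounded_operators s1 s2 \<subseteq> WR"
  proof
    fix T assume T: "T \<in> bounded_operators s1 s2"
    have "\<exists>R\<in>range_covering s1 s2 (range A1) (range A2).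
        \<forall>(x, y)\<in>F. norm (ip2 (R x) y - ip2 (T x) y) < \<epsilon>"
      if F: "finite F" "0 < \<epsilon>" for F :: "('a \<times> 'b) set" and \<epsilon>
    proof -
      from F(1) have "finite (snd ` F)" by blast
      from P02.orthonormal_complement_basis[OF ss2 this] obtain r w where
        w: "r \<le> card (snd ` F)" "H2.orthonormal {..<r} w" "\<And>i n. i < r \<Longrightarrow> ip2 (v n) (w i) = 0"
          "\<And>b. b \<in> snd ` F \<Longrightarrow> \<exists>p\<in>H2.span (w ` {..<r}). b - p \<in> closure (range A2)"
        by metis
      obtain C where C: "\<And>n. t n \<le> C * s (n + r)"
        using majorizes_shift_mono[OF assms[of r] order_refl] by blast
      show ?thesis
        by (rule covering_approximation[OF ss1 ss2 T w(2,3) C refl F]) (use w(4) in auto)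
    qed
    with T show "T \<in> WR" unfolding weak_range_covering_iff by blast
  qed
qed

text \<open>At most \<open>k\<close> orthonormal vectors orthogonal to the second range describe the
  image of \<open>T\<close> modulo the closure, and the same vectors work in every weak
  neighbourhood.\<close>

lemma weak_range_covering_finite_codim:
  assumes k: "majorizes (left_shift k s) t" and T: "T \<in> bounded_operators s1 s2"
    and dim: "dim_modulo_le s2 (closure (range A2)) (T ` range A1) k"
  shows "T \<in> WR"
proof -
  obtain Q where Q: "Q \<in> bounded_operators s2 s2" "\<And>y. Q y = 0 \<longleftrightarrow> y \<in> closure (range A2)"
    using P02.projection_complement_range[OF ss2] by metis
  from H2.dim_modulo_leD[OF Q dim] obtain B where B: "finite B" "card B \<le> k"
    "\<And>x. x \<in> T ` range A1 \<Longrightarrow> \<exists>y\<in>H2.span B. x - y \<in> closure (range A2)" by metis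
  from P02.orthonormal_complement_basis[OF ss2 B(1)] obtain r w where
    w: "r \<le> card B" "H2.orthonormal {..<r} w" "\<And>i n. i < r \<Longrightarrow> ip2 (v n) (w i) = 0"
      "\<And>b. b \<in> B \<Longrightarrow> \<exists>p\<in>H2.span (w ` {..<r}). b - p \<in> closure (range A2)"
    by metis
  define M where "M = {y. \<exists>p\<in>H2.span (w ` {..<r}). y - p \<in> closure (range A2)}"
  interpret P22: hilbert_pair s2 ip2 s2 ip2 ..
  have M_iff: "y \<in> M \<longleftrightarrow> (\<exists>p\<in>H2.span (w ` {..<r}). Q y = Q p)" for y
    by (simp add: M_def Q(2)[symmetric] P22.bo_diff[OF Q(1)])
  have M_add: "y + z \<in> M" if "y \<in> M" "z \<in> M" for y z
    using that H2.span_add unfolding M_iff P22.bo_add[OF Q(1)] by (metis P22.bo_add[OF Q(1)])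
  have M_scale: "s2 c y \<in> M" if "y \<in> M" for c y
    using that H2.span_scale unfolding M_iff P22.bo_scale[OF Q(1)] by (metis P22.bo_scale[OF Q(1)])
  have M0: "0 \<in> M" unfolding M_iff using H2.span_zero by blast
  have "H2.subspace M" unfolding H2.subspace_def using M_add M_scale M0 by blast
  then have "H2.span B \<subseteq> M" using w(4) by (intro H2.span_minimal) (auto simp: M_def)
  then have TM: "y \<in> M" if "y \<in> T ` range A1" for y
  proof -
    from B(3)[OF that] obtain p where p: "p \<in> H2.span B" "y - p \<in> closure (range A2)" by blast
    then have "Q y = Q p" by (simp add: Q(2)[symmetric] P22.bo_diff[OF Q(1)])
    moreover have "p \<in> M" using p(1) \<open>H2.span B \<subseteq> M\<close> by blast
    ultimately show ?thesis by (simp add: M_iff)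
  qed
  obtain C where C: "\<And>n. t n \<le> C * s (n + r)"
    using majorizes_shift_mono[OF k order_trans[OF w(1) B(2)]] by blast
  have "\<exists>R\<in>range_covering s1 s2 (range A1) (range A2).
      \<forall>(x, y)\<in>F. norm (ip2 (R x) y - ip2 (T x) y) < \<epsilon>"
    if F: "finite F" "0 < \<epsilon>" for F :: "('a \<times> 'b) set" and \<epsilon>
    by (rule covering_approximation[OF ss1 ss2 T w(2,3) C M_def F]) (use TM in auto)
  with T show ?thesis unfolding weak_range_covering_iff by blast
qed

text \<open>A dimension above \<open>k\<close> provides \<open>k + 1\<close> vectors
  \<open>T (x i)\<close> that are biorthogonal to unit vectors \<open>w j\<close> orthogonal to the
  second range. A covering operator weakly close to \<open>T\<close> nearly preserves these
  pairings, and \<open>covering_bound\<close> then yields majorization by the shift of order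
  \<open>k + 1\<close>.\<close>

lemma weak_range_covering_dim_le:
  assumes k: "\<not> majorizes (left_shift (Suc k) s) t" and T: "T \<in> WR"
  shows "dim_modulo_le s2 (closure (range A2)) (T ` range A1) k"
proof (rule ccontr)
  assume dim: "\<not> dim_modulo_le s2 (closure (range A2)) (T ` range A1) k"
  interpret P22: hilbert_pair s2 ip2 s2 ip2 ..
  obtain Q where Q: "Q \<in> bounded_operators s2 s2" "\<And>y. Q y = 0 \<longleftrightarrow> y \<in> closure (range A2)"
    "\<And>y n. ip2 (Q y) (v n) = 0" "\<And>y. y - Q y \<in> closure (range A2)"
    using P02.projection_complement_range[OF ss2] by metis
  have Tb: "T \<in> bounded_operators s1 s2" using T weak_range_covering_iff by blast
  have hom: "module_hom s1 s2 T" "module_hom s2 s2 Q"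
    using Tb Q(1) by (auto simp: bounded_operators_def linear_iff_module_hom)
  have sub: "H2.subspace (T ` range A1)"
    by (rule module_hom.subspace_image[OF hom(1) P01.subspace_range[OF ss1]])
  from H2.not_dim_modulo_leD[OF Q(1,2) sub dim] obtain C where
    C: "finite C" "card C = Suc k" "C \<subseteq> Q ` T ` range A1" "H2.independent C" by metis
  from H2.gram_schmidt[OF C(1)] obtain n w where
    w: "n \<le> card C" "H2.orthonormal {..<n} w" "H2.span (w ` {..<n}) = H2.span C" by blast
  have "card C \<le> card (w ` {..<n})"
    using H2.independent_span_bound[of "w ` {..<n}" C] C(4) w(3) H2.span_superset[of C] by auto
  also have "\<dots> \<le> n" using card_image_le[of "{..<n}" w] by simp
  finally have n: "n = Suc k" using w(1) C(2) by simp
  have "H2.span C \<subseteq> Q ` T ` range A1"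
    using C(3) module_hom.subspace_image[OF hom(2) sub] by (intro H2.span_minimal)
  then have wQ: "w i \<in> Q ` T ` range A1" if "i < n" for i
    using that w(3) H2.span_base[of "w i" "w ` {..<n}"] by blast
  have "\<forall>i\<in>{..<n}. \<exists>x. x \<in> range A1 \<and> Q (T x) = w i"
  proof
    fix i assume "i \<in> {..<n}"
    then have "w i \<in> Q ` T ` range A1" using wQ by simp
    then obtain y where y: "w i = Q y" "y \<in> T ` range A1" by (rule imageE)
    from y(2) obtain x where "y = T x" "x \<in> range A1" by (rule imageE)
    with y(1) show "\<exists>x. x \<in> range A1 \<and> Q (T x) = w i" by auto
  qed
  from bchoice[OF this] obtain x where "\<forall>i\<in>{..<n}. x i \<in> range A1 \<and> Q (T (x i)) = w i" ..
  then have x: "\<And>i. i < n \<Longrightarrow> x i \<in> range A1" "\<And>i. i < n \<Longrightarrow> Q (T (x i)) = w i" by auto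
  have vw: "ip2 (v j) (w i) = 0" if "i < n" for i j
    using Q(3)[of "T (x i)" j] x(2)[OF that] H2.ip_eq_0_commute by simp
  \<comment> \<open>\<open>T (x i)\<close> differs from its projection \<open>w i\<close> by an
    element of the closed range, to which \<open>w j\<close> is orthogonal.\<close>
  have ipT: "ip2 (T (x i)) (w j) = of_bool (i = j)" if "i < n" "j < n" for i j
  proof -
    have "ip2 (T (x i) - Q (T (x i))) (w j) = 0"
      by (rule P02.orthogonal_closure_range[OF ss2 vw[OF that(2)] Q(4)])
    then show ?thesis using x(2)[OF that(1)] H2.orthonormalD[OF w(2)] that by (simp add: H2.ip_diff_left)
  qed
  define F where "F = (\<lambda>(i, j). (x i, w j)) ` ({..<n} \<times> {..<n})"
  have "finite F" "0 < 1 / (2 * real n)" using n by (auto simp: F_def)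
  with T obtain R where R: "R \<in> range_covering s1 s2 (range A1) (range A2)"
    "\<forall>(x, y)\<in>F. norm (ip2 (R x) y - ip2 (T x) y) < 1 / (2 * real n)"
    unfolding weak_range_covering_iff by blast
  have Rb: "R \<in> bounded_operators s1 s2" "range A2 \<subseteq> R ` range A1"
    using R(1) by (auto simp: range_covering_def)
  have close: "norm (of_bool (i = j) - ip2 (R (x i)) (w j)) \<le> 1 / (2 * real n)" if "i < n" "j < n" for i j
  proof -
    have "(x i, w j) \<in> F" using that by (auto simp: F_def)
    with R(2) have "norm (ip2 (R (x i)) (w j) - ip2 (T (x i)) (w j)) < 1 / (2 * real n)" by fast
    then show ?thesis unfolding ipT[OF that] by (simp add: norm_minus_commute)
  qed
  have w1: "norm (w i) = 1" if "i < n" for i using H2.orthonormal_norm[OF w(2)] that by simp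
  obtain C' where "C' > 0" "\<And>m. t m \<le> C' * s (m + n)"
    using covering_bound[OF ss1 ss2 Rb x(1) w1 vw close] by blast
  then have "majorizes (left_shift (Suc k) s) t"
    unfolding majorizes_def left_shift_def n by blast
  with k show False by contradiction
qed

lemma image_closure_subset:
  assumes T: "T \<in> bounded_operators s1 s2"
    and dim: "dim_modulo_le s2 (closure (range A2)) (T ` range A1) 0"
  shows "T ` closure (range A1) \<subseteq> closure (range A2)"
proof -
  obtain Q where Q: "Q \<in> bounded_operators s2 s2" "\<And>y. Q y = 0 \<longleftrightarrow> y \<in> closure (range A2)"
    using P02.projection_complement_range[OF ss2] by metis
  from H2.dim_modulo_leD[OF Q dim] obtain B where B: "finite B" "card B \<le> 0"
    "\<And>x. x \<in> T ` range A1 \<Longrightarrow> \<exists>y\<in>H2.span B. x - y \<in> closure (range A2)" by metis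
  then have "T ` range A1 \<subseteq> closure (range A2)" by auto
  then show ?thesis
    by (intro image_closure_subset linear_continuous_on P12.bo_bounded_linear[OF T]) auto
qed

end

end

text \<open>A positive limit inferior bounds all but finitely many ratios from below, and the
  remaining ratios are positive.\<close>

lemma ratio_bounded_below:
  fixes a :: "nat \<Rightarrow> real"
  assumes pos: "\<And>n. 0 < a n" and dec: "decseq a" and lim: "a \<longlonglongrightarrow> 0" and "\<not> lacunary a"
  obtains c where "c > 0" "\<And>n. c * a n \<le> a (Suc n)"
proof -
  let ?r = "\<lambda>n. a (Suc n) / a n"
  have "liminf (\<lambda>n. ereal (?r n)) \<noteq> 0" using assms by (auto simp: lacunary_def)
  moreover have "0 \<le> liminf (\<lambda>n. ereal (?r n))"
    using pos by (intro Liminf_bounded always_eventually) (auto simp: less_imp_le)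
  ultimately have "0 < liminf (\<lambda>n. ereal (?r n))" by simp
  then obtain c where c: "0 < ereal c" "ereal c < liminf (\<lambda>n. ereal (?r n))"
    using ereal_dense2 by blast
  from less_LiminfD[OF c(2)] obtain N where N: "\<And>n. n \<ge> N \<Longrightarrow> c < ?r n"
    by (auto simp: eventually_sequentially)
  define d where "d = Min (insert c (?r ` {..<N}))"
  have "d > 0" using c(1) pos by (auto simp: d_def)
  moreover have "d \<le> ?r n" for n
  proof (cases "n < N")
    case False
    then have "c < ?r n" using N by simp
    moreover have "d \<le> c" by (simp add: d_def)
    ultimately show ?thesis by linarith
  qed (simp add: d_def)
  then have "d * a n \<le> a (Suc n)" for n using pos[of n] by (simp add: le_divide_eq)
  ultimately show thesis by (rule that)
qed

lemma majorizes_left_shift_self: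
  assumes c: "c > 0" "\<And>n. c * a n \<le> a (Suc n)"
  shows "majorizes (left_shift k a) a"
proof -
  have "c ^ k * a n \<le> a (n + k)" for n
  proof (induction k)
    case (Suc k)
    have "c ^ Suc k * a n \<le> c * a (n + k)" using mult_left_mono[OF Suc, of c] c(1) by (simp add: mult.assoc)
    with c(2)[of "n + k"] show ?case by simp
  qed simp
  then have "a n \<le> a (n + k) / c ^ k" for n
    using c(1) by (simp add: pos_le_divide_eq mult.commute)
  then show ?thesis
    using c(1) unfolding majorizes_def left_shift_def
    by (intro exI[of _ "inverse (c ^ k)"]) (simp add: divide_inverse mult.commute)
qed

theorem corollary7p1:
  fixes sH :: "'k::rc_field \<Rightarrow> 'h::{real_inner, banach} \<Rightarrow> 'h" and ipH :: "'h \<Rightarrow> 'h \<Rightarrow> 'k"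
    and s1 :: "'k \<Rightarrow> 'a::{real_inner, banach} \<Rightarrow> 'a" and ip1 :: "'a \<Rightarrow> 'a \<Rightarrow> 'k"
    and s2 :: "'k \<Rightarrow> 'b::{real_inner, banach} \<Rightarrow> 'b" and ip2 :: "'b \<Rightarrow> 'b \<Rightarrow> 'k"
    and A1 :: "'h \<Rightarrow> 'a" and A2 :: "'h \<Rightarrow> 'b"
    and Y1 :: "'a set" and Y2 :: "'b set"
  assumes "hilbert_space sH ipH" "hilbert_space s1 ip1" "hilbert_space s2 ip2"
    and "separable_space (euclidean :: 'h topology)"
    and "separable_space (euclidean :: 'a topology)"
    and "separable_space (euclidean :: 'b topology)"
    and "infinite_dimensional sH UNIV"
    and "infinite_dimensional s1 UNIV"
    and "infinite_dimensional s2 UNIV"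
    and "compact_operator sH s1 A1" "infinite_dimensional s1 (range A1)"
    and "compact_operator sH s2 A2" "infinite_dimensional s2 (range A2)"
    and "Y1 = range A1" "Y2 = range A2"
    and "class_majorizes (width_class sH s1 Y1) (width_class sH s2 Y2)"
  shows
    "((\<forall>k. class_majorizes (left_shift k ` width_class sH s1 Y1) (width_class sH s2 Y2)) \<longrightarrow>
        weak_range_covering s1 s2 ip2 Y1 Y2 = bounded_operators s1 s2) \<and>
     (\<forall>k. class_majorizes (left_shift k ` width_class sH s1 Y1) (width_class sH s2 Y2) \<and>
          \<not> class_majorizes (left_shift (k + 1) ` width_class sH s1 Y1) (width_class sH s2 Y2) \<longrightarrow>
        weak_range_covering s1 s2 ip2 Y1 Y2 =
          {T \<in> bounded_operators s1 s2. dim_modulo_le s2 (closure Y2) (T ` Y1) k}) \<and>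
     (\<not> class_majorizes (left_shift 1 ` width_class sH s1 Y1) (width_class sH s2 Y2) \<longrightarrow>
        (\<forall>T \<in> weak_range_covering s1 s2 ip2 Y1 Y2. T ` closure Y1 \<subseteq> closure Y2)) \<and>
     (\<not> lacunary_class (width_class sH s1 Y1) \<longrightarrow>
        weak_range_covering s1 s2 ip2 Y1 Y2 = bounded_operators s1 s2) \<and>
     (closure Y1 = UNIV \<and> closure Y2 = UNIV \<longrightarrow>
        weak_range_covering s1 s2 ip2 Y1 Y2 = bounded_operators s1 s2)"
proof -
  interpret hilbert_triple sH ipH s1 ip1 s2 ip2
    by (rule hilbert_triple.intro) fact+
  obtain e u s where ss1: "P01.singular_system A1 e u s"
    using P01.singular_system_exists[OF assms(10,11)] .
  obtain f v t where ss2: "P02.singular_system A2 f v t"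
    using P02.singular_system_exists[OF assms(12,13)] .
  let ?WR = "weak_range_covering s1 s2 ip2 (range A1) (range A2)"
  have iff: "class_majorizes (left_shift k ` width_class sH s1 (range A1)) (width_class sH s2 (range A2))
      \<longleftrightarrow> majorizes (left_shift k s) t" for k
    by (rule class_majorizes_iff[OF ss1 ss2 assms(10-13)])
  have "left_shift 0 = id" by (auto simp: left_shift_def)
  with iff[of 0] assms(14-16) have st: "majorizes s t" by simp
  note Y = assms(14,15)
  have all: "?WR = bounded_operators s1 s2" if "\<And>k. majorizes (left_shift k s) t"
    by (rule weak_range_covering_all[OF ss1 ss2 that])
  have WR: "?WR = {T \<in> bounded_operators s1 s2. dim_modulo_le s2 (closure (range A2)) (T ` range A1) k}"
    if "majorizes (left_shift k s) t" "\<not> majorizes (left_shift (Suc k) s) t" for k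
    using weak_range_covering_finite_codim[OF ss1 ss2 that(1)] weak_range_covering_dim_le[OF ss1 ss2 that(2)]
      weak_range_covering_iff[OF ss1 ss2] by blast
  have nonlacunary: "majorizes (left_shift k s) t" if lac: "\<not> lacunary_class (width_class sH s1 (range A1))" for k
  proof -
    from lac obtain a where a: "a \<in> width_class sH s1 (range A1)" "decseq a" "\<not> lacunary a"
      by (auto simp: lacunary_class_def)
    note eq = P01.width_class_equivalent[OF ss1 a(1)]
    from eq(2) obtain C where C: "C > 0" "\<And>n. a n \<le> C * s n" by (auto simp: majorizes_def)
    \<comment> \<open>For a decreasing positive sequence tending to 0, failing to be lacunary means
      that the limit inferior of the ratios is not 0.\<close>
    have "a \<longlonglongrightarrow> 0"
    proof (rule tendsto_sandwich[OF _ _ tendsto_const])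
      show "(\<lambda>n. C * s n) \<longlonglongrightarrow> 0" using tendsto_mult_right_zero[OF P01.ss_tendsto[OF ss1]] .
    qed (use eq(3) C(2) in \<open>auto intro!: always_eventually less_imp_le\<close>)
    from ratio_bounded_below[OF eq(3) a(2) this a(3)] obtain c where
      c: "c > 0" "\<And>n. c * a n \<le> a (Suc n)" by blast
    \<comment> \<open>In the chain shifted \<open>s\<close>, shifted \<open>a\<close>,
      \<open>a\<close>, \<open>s\<close>, \<open>t\<close>, each sequence majorizes the
      next.\<close>
    show ?thesis
      using majorizes_trans[OF majorizes_trans[OF majorizes_trans[OF
        majorizes_left_shift[OF eq(2)] majorizes_left_shift_self[where a = a, OF c]] eq(1)] st] .
  qed
  have dense: "?WR = bounded_operators s1 s2" if "closure (range A2) = UNIV"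
  proof (cases "\<forall>k. majorizes (left_shift k s) t")
    case False
    \<comment> \<open>The least failing shift is positive because \<open>s\<close> majorizes
      \<open>t\<close>, so its predecessor \<open>m\<close> satisfies both conditions of the
      dimension criterion. Modulo the whole space every image has dimension 0, and the criterion
      admits every \<open>T\<close>.\<close>
    define k where "k = (LEAST k. \<not> majorizes (left_shift k s) t)"
    from False have k: "\<not> majorizes (left_shift k s) t" unfolding k_def by (metis LeastI)
    have "k \<noteq> 0" using k st \<open>left_shift 0 = id\<close> by (metis id_apply)
    then obtain m where m: "k = Suc m" using not0_implies_Suc by blast
    have "majorizes (left_shift m s) t" using not_less_Least[of m "\<lambda>k. \<not> majorizes (left_shift k s) t"] m
      unfolding k_def by auto
    moreover have "dim_modulo_le s2 UNIV (T ` range A1) m" for T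
      unfolding dim_modulo_le_def finite_basis_modulo_def
    proof (intro exI[of _ "{}"] conjI)
      have "x +o UNIV = UNIV" for x :: 'b
        by (auto simp: elt_set_plus_def intro: exI[of _ "_ - x"])
      then show "(\<lambda>x. x +o UNIV) ` T ` range A1 = (\<lambda>x. x +o UNIV) ` H2.span {}" by auto
    qed auto
    ultimately show ?thesis using WR[of m] k that by (simp add: m)
  qed (use all in blast)
  have first: "T ` closure (range A1) \<subseteq> closure (range A2)"
    if "\<not> majorizes (left_shift 1 s) t" "T \<in> ?WR" for T
  proof -
    have "majorizes (left_shift 0 s) t" using st \<open>left_shift 0 = id\<close> by simp
    with WR[of 0] that show ?thesis by (intro image_closure_subset[OF ss1 ss2]) auto
  qed
  show ?thesis
    unfolding Y iff using all WR nonlacunary dense first by simp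
qed

end
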